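(* Let $\mathcal F$ be an admissible sequence of polynomials and let $\lambda$ be a strict partition. For two sets of variables $\boldsymbol{x}=(x_1,\dots,x_n)$ and $\boldsymbol{y}=(y_1,\dots,y_p)$, we have $$P^{\mathcal F}_\lambda(\boldsymbol{x},\boldsymbol{y})=\sum_\mu P^{\mathcal F}_{\lambda/\mu,p}(\boldsymbol{x})\,P^{\mathcal F}_\mu(\boldsymbol{y}),$$ where $\mu$ runs over all strict partitions.
   Context: $K$ is a field of characteristic $0$. A sequence $\mathcal F=\{f_d\}_{d=0}^\infty$ of polynomials $f_d(u)\in K[u]$ is admissible if $f_0=1$ and $\deg f_d=d$ for all $d\ge 1$. A strict partition of length $l$ is a strictly decreasing sequence $\lambda=(\lambda_1>\dots>\lambda_l)$ of positive integers (the empty sequence $\emptyset$ has length $0$); put $\lambda^0=(\lambda_1,\dots,\lambda_l,0)$. ${}^tM$ denotes the transpose of $M$, $O$ a zero matrix, and $\mathrm{Pf}$ the Pfaffian (the empty Pfaffian is $1$). For indeterminates $\boldsymbol{x}=(x_1,\dots,x_n)$ put $A(\boldsymbol{x})=\left(\frac{x_j-x_i}{x_j+x_i}\right)_{1\le i,j\le n}$ and $\Delta(\boldsymbol{x})=\prod_{1\le i<j\le n}\frac{x_j-x_i}{x_j+x_i}$. For a sequence $\alpha=(\alpha_1,\dots,\alpha_r)$ of nonnegative integers let $V^{\mathcal F}_\alpha(\boldsymbol{x})=(f_{\alpha_j}(x_i))_{1\le i\le n,\,1\le j\le r}$. For a strict partition $\lambda$ of length $l$, the generalized $P$-function is $$P^{\mathcal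 F}_\lambda(\boldsymbol{x})=\frac{1}{\Delta(\boldsymbol{x})}\mathrm{Pf}\begin{pmatrix}A(\boldsymbol{x})&V^{\mathcal F}_{\lambda^*}(\boldsymbol{x})\\-{}^tV^{\mathcal F}_{\lambda^*}(\boldsymbol{x})&O\end{pmatrix},$$ where $\lambda^*=\lambda$ if $n+l$ is even and $\lambda^*=\lambda^0$ if $n+l$ is odd; it is a symmetric polynomial in $\boldsymbol x$. Conventions: $P^{\mathcal F}_{(0)}=1$, and for positive integers $r,s$, $P^{\mathcal F}_{(s,r)}=-P^{\mathcal F}_{(r,s)}$, $P^{\mathcal F}_{(r,0)}=-P^{\mathcal F}_{(0,r)}=P^{\mathcal F}_{(r)}$, $P^{\mathcal F}_{(0,0)}=0$. $P^{\mathcal F}_\lambda(\boldsymbol x,\boldsymbol y)$ is the generalized $P$-function in the $n+p$ variables $x_1,\dots,x_n,y_1,\dots,y_p$. Generalized skew $P$-functions: for nonnegative integers $r,k$ define symmetric polynomials $R^{\mathcal F}_{r/k}(\boldsymbol{x})$ by $$P^{\mathcal F}_{(r)}(x_1,\dots,x_n,y)=\sum_{k=0}^\infty R^{\mathcal F}_{r/k}(x_1,\dots,x_n)f_k(y).$$ For sequences $\alpha=(\alpha_1,\dots,\alpha_r)$, $\beta=(\beta_1,\dots,\beta_s)$ of nonnegative integers put $S^{\mathcal F}_\alpha(\boldsymbol{x})=\big(P^{\mathcal F}_{(\alpha_i,\alpha_j)}(\boldsymbol{x})\big)_{1\le i,j\le r}$ and $M^{\mathcal F}_{\alpha/\beta}(\boldsymbol{x})=\big(R^{\mathcal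 F}_{\alpha_i/\beta_{s+1-j}}(\boldsymbol{x})\big)_{1\le i\le r,\,1\le j\le s}$. For strict partitions $\lambda$ of length $l$ and $\mu$ of length $m$ and a positive integer $p$, define $$P^{\mathcal F}_{\lambda/\mu,p}(\boldsymbol{x})=\mathrm{Pf}\begin{pmatrix}S^{\mathcal F}_{\lambda^\#}(\boldsymbol{x})&M^{\mathcal F}_{\lambda^\#/\mu^\#}(\boldsymbol{x})\\-{}^tM^{\mathcal F}_{\lambda^\#/\mu^\#}(\boldsymbol{x})&O\end{pmatrix},$$ where $\lambda^\#=\lambda$ if $l\equiv p \bmod 2$ and $\lambda^\#=\lambda^0$ otherwise, and $\mu^\#=\mu$ if $m\equiv p\bmod 2$ and $\mu^\#=\mu^0$ otherwise. *)

theory Defs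
  imports
    "Jordan_Normal_Form.Determinant"
    "HOL-Computational_Algebra.Polynomial_Factorial"
    "HOL-Library.Poly_Mapping"
begin

text \<open>
  All functions below take a polynomial sequence \<open>f\<close> and a list \<open>xs\<close> of points of one common
  field. The indeterminates of the paper are the generators of the field of rational functions
  defined next. Lists are indexed from \<open>0\<close>, so the paper's \<open>x\<^sub>i\<close> is \<open>xs ! (i - 1)\<close>.
\<close>

text \<open>The field of fractions of \<open>K[X\<^sub>0, X\<^sub>1, X\<^sub>2, \<dots>]\<close>; a monomial is a finitely supported
  exponent vector \<open>nat \<Rightarrow>\<^sub>0 nat\<close>.\<close>

type_synonym 'a ratfun = "((nat \<Rightarrow>\<^sub>0 nat) \<Rightarrow>\<^sub>0 'a) fract"

definition indet :: "nat \<Rightarrow> 'a::field ratfun" where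
  "indet i = to_fract (Poly_Mapping.single (Poly_Mapping.single i 1) 1)"

definition scalar :: "'a::field \<Rightarrow> 'a ratfun" where
  "scalar c = to_fract (Poly_Mapping.single 0 c)"

definition admissible :: "(nat \<Rightarrow> 'a::field poly) \<Rightarrow> bool" where
  "admissible f \<longleftrightarrow> f 0 = 1 \<and> (\<forall>d\<ge>1. degree (f d) = d)"

definition strict_partition :: "nat list \<Rightarrow> bool" where
  "strict_partition \<alpha> \<longleftrightarrow> sorted_wrt (>) \<alpha> \<and> (\<forall>a\<in>set \<alpha>. 0 < a)"

text \<open>For a skew-symmetric matrix of order \<open>2 m\<close> over a field of characteristic \<open>0\<close> (the only
  case in which it is used): each perfect matching is counted \<open>2\<^sup>m m!\<close> times in the sum.\<close>

definition pfaffian :: "'b::field mat \<Rightarrow> 'b" where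
  "pfaffian A = (let m = dim_row A div 2 in
     (\<Sum>\<sigma> | \<sigma> permutes {0..<2 * m}.
        signof \<sigma> * (\<Prod>i = 0..<m. A $$ (\<sigma> (2 * i), \<sigma> (2 * i + 1))))
     / of_nat (2 ^ m * fact m))"

definition bordered :: "'b::field mat \<Rightarrow> 'b mat \<Rightarrow> 'b mat" where
  "bordered S M = four_block_mat S M (- transpose_mat M) (0\<^sub>m (dim_col M) (dim_col M))"

definition A_mat :: "'b::field list \<Rightarrow> 'b mat" where
  "A_mat xs = mat (length xs) (length xs) (\<lambda>(i, j). (xs ! j - xs ! i) / (xs ! j + xs ! i))"

definition Delta :: "'b::field list \<Rightarrow> 'b" where
  "Delta xs = (\<Prod>j<length xs. \<Prod>i<j. (xs ! j - xs ! i) / (xs ! j + xs ! i))"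

definition V_mat :: "(nat \<Rightarrow> 'b::field poly) \<Rightarrow> nat list \<Rightarrow> 'b list \<Rightarrow> 'b mat" where
  "V_mat f \<alpha> xs = mat (length xs) (length \<alpha>) (\<lambda>(i, j). poly (f (\<alpha> ! j)) (xs ! i))"

text \<open>Appends a part \<open>0\<close> unless the length has the same parity as \<open>k\<close>. This gives
  \<open>\<lambda>\<^sup>*\<close> for \<open>k = n\<close>, and both \<open>\<lambda>\<^sup>#\<close> and \<open>\<mu>\<^sup>#\<close> for \<open>k = p\<close>.\<close>

definition pad :: "nat \<Rightarrow> nat list \<Rightarrow> nat list" where
  "pad k \<alpha> = (if even (k + length \<alpha>) then \<alpha> else \<alpha> @ [0])"

definition P_fun :: "(nat \<Rightarrow> 'b::field poly) \<Rightarrow> nat list \<Rightarrow> 'b list \<Rightarrow> 'b" where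
  "P_fun f \<alpha> xs =
     pfaffian (bordered (A_mat xs) (V_mat f (pad (length xs) \<alpha>) xs)) / Delta xs"

text \<open>\<open>P\<^bsub>(0)\<^esub> = 1\<close>, and \<open>P\<^bsub>(r,s)\<^esub>\<close> is extended antisymmetrically to all nonnegative \<open>r, s\<close>; in
  particular \<open>P\<^bsub>(r,r)\<^esub> = 0\<close>.\<close>

definition P_one :: "(nat \<Rightarrow> 'b::field poly) \<Rightarrow> nat \<Rightarrow> 'b list \<Rightarrow> 'b" where
  "P_one f r xs = (if r = 0 then 1 else P_fun f [r] xs)"

definition P_two :: "(nat \<Rightarrow> 'b::field poly) \<Rightarrow> nat \<Rightarrow> nat \<Rightarrow> 'b list \<Rightarrow> 'b" where
  "P_two f r s xs =
     (if r = s then 0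
      else if s = 0 then P_one f r xs
      else if r = 0 then - P_one f s xs
      else if s < r then P_fun f [r, s] xs
      else - P_fun f [s, r] xs)"

text \<open>The extra variable \<open>y\<close> is the generator of the field of rational functions in one variable
  over the field containing \<open>xs\<close>; \<open>const\<close> embeds the latter field. The coefficients are unique
  because \<open>y\<close> is transcendental and an admissible sequence is a basis of the polynomials.\<close>

definition const :: "'b::field \<Rightarrow> 'b poly fract" where
  "const c = to_fract [:c:]"

definition new_var :: "'b::field poly fract" where
  "new_var = to_fract [:0, 1:]"

definition R_coeffs :: "(nat \<Rightarrow> 'b::field poly) \<Rightarrow> nat \<Rightarrow> 'b list \<Rightarrow> nat \<Rightarrow> 'b" where
  "R_coeffs f r xs = (THE c. finite {k. c k \<noteq> 0} \<and>
     P_one (\<lambda>d. map_poly const (f d)) r (map const xs @ [new_var]) =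
       (\<Sum>k | c k \<noteq> 0. const (c k) * poly (map_poly const (f k)) new_var))"

definition R_fun :: "(nat \<Rightarrow> 'b::field poly) \<Rightarrow> nat \<Rightarrow> nat \<Rightarrow> 'b list \<Rightarrow> 'b" where
  "R_fun f r k xs = R_coeffs f r xs k"

definition S_mat :: "(nat \<Rightarrow> 'b::field poly) \<Rightarrow> nat list \<Rightarrow> 'b list \<Rightarrow> 'b mat" where
  "S_mat f \<alpha> xs = mat (length \<alpha>) (length \<alpha>) (\<lambda>(i, j). P_two f (\<alpha> ! i) (\<alpha> ! j) xs)"

definition M_mat :: "(nat \<Rightarrow> 'b::field poly) \<Rightarrow> nat list \<Rightarrow> nat list \<Rightarrow> 'b list \<Rightarrow> 'b mat" where
  "M_mat f \<alpha> \<beta> xs = mat (length \<alpha>) (length \<beta>)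
     (\<lambda>(i, j). R_fun f (\<alpha> ! i) (\<beta> ! (length \<beta> - 1 - j)) xs)"

definition P_skew ::
  "(nat \<Rightarrow> 'b::field poly) \<Rightarrow> nat list \<Rightarrow> nat list \<Rightarrow> nat \<Rightarrow> 'b list \<Rightarrow> 'b" where
  "P_skew f \<alpha> \<beta> p xs = pfaffian (bordered (S_mat f (pad p \<alpha>) xs) (M_mat f (pad p \<alpha>) (pad p \<beta>) xs))"

end

theory Submission
  imports Defs "Jordan_Normal_Form.Char_Poly"
begin

text \<open>
  For a form \<open>g\<close> on an alphabet, let \<open>pf g w\<close> be the Pfaffian of the matrix \<open>g (w ! i) (w ! j)\<close>. The
  generalized \<open>P\<close>-functions become Pfaffians of words over one alphabet, whose letters are points,
  the polynomials of the sequence, and one auxiliary letter that makes the number of points even: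
  the numerator of \<open>P\<^sub>\<lambda>(x)\<close> is the Pfaffian of the word \<open>x \<lambda>\<close>, and \<open>\<Delta>(x)\<close> is the Pfaffian of the
  word \<open>x\<close> by Schur's identity (\<open>pf_pts\<close>).

  In the word \<open>x y \<lambda>\<close> for \<open>P\<^sub>\<lambda>(x, y)\<close>, divide by the Pfaffian of \<open>x\<close>. By the Pfaffian form of
  Sylvester's identity (\<open>pf_quotient\<close>) the result is the Pfaffian of the word \<open>y \<lambda>\<close> for the form with
  entries \<open>pf (x a b) / pf x\<close>. These entries are known: between two points of \<open>y\<close> one gets Schur's
  entry back, up to factors that account for the mixed part of \<open>\<Delta>(x, y)\<close>; between two parts \<open>r\<close>, \<open>s\<close>
  of \<open>\<lambda>\<close> one gets \<open>P\<^bsub>(r,s)\<^esub>(x)\<close>; between a point \<open>t\<close> of \<open>y\<close> and a part \<open>r\<close> one gets, up to the factor of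
  \<open>t\<close>, the function \<open>P\<^bsub>(r)\<^esub>(x, t)\<close> (\<open>P_fun_append_eq_joined\<close>).

  The last function is a polynomial in \<open>t\<close>, because its possible poles at the points of \<open>x\<close> are
  cancelled by zeros of a Pfaffian with a repeated letter (\<open>P_one_polynomial\<close>). Hence it is the sum of
  \<open>R\<^bsub>r/k\<^esub>(x) f\<^sub>k(t)\<close> over \<open>k\<close>, and the block of mixed entries is a product of two matrices. A minor
  summation formula (\<open>pf_minor_summation\<close>) expands the Pfaffian of such a matrix as a sum over sets \<open>K\<close>
  of indices \<open>k\<close>; the term of \<open>K\<close> is the product of the Pfaffians of the words \<open>y K\<close> and \<open>K \<lambda>\<close>,
  the second word with \<open>K\<close> reversed. For \<open>K\<close> of the right parity these two are, up to \<open>\<Delta>(y)\<close>, the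
  functions \<open>P\<^sub>\<mu>(y)\<close> and \<open>P\<^bsub>\<lambda>/\<mu>\<^esub>(x)\<close>, where \<open>K\<close> consists of the parts of \<open>\<mu>\<close> and possibly \<open>0\<close>.

  Of the indeterminates, the argument uses that they are distinct and that no sum \<open>z\<^sub>i + z\<^sub>j\<close>, with \<open>i = j\<close>
  included, is zero. So the formula is proved for arbitrary such points of a field of characteristic \<open>0\<close> (\<open>P_fun_splitting\<close>).
\<close>

section \<open>Expansions along a row\<close>

text \<open>This is \<open>\<Sum>i<length w. (- 1) ^ i * G (w ! i) (w without its i-th letter)\<close>, the shape of an
  expansion of a Pfaffian along its first row. The structural recursion lets identities between
  nested expansions be proved by induction on words, without index arithmetic.\<close>

fun laplace :: "'i list \<Rightarrow> ('i \<Rightarrow> 'i list \<Rightarrow> 'b::comm_ring_1) \<Rightarrow> 'b" where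
  "laplace [] G = 0"
| "laplace (a # w) G = G a w - laplace w (\<lambda>b t. G b (a # t))"

text \<open>The bounds on \<open>t\<close> make the recursive call in \<open>pf\<close> below terminate.\<close>

lemma laplace_cong [fundef_cong]:
  assumes "v = w"
    and "\<And>b t. b \<in> set w \<Longrightarrow> set t \<subseteq> set w \<Longrightarrow> length w = Suc (length t) \<Longrightarrow> G b t = H b t"
  shows "laplace v G = laplace w H"
  unfolding assms(1) using assms(2)
proof (induction w arbitrary: G H)
  case (Cons a w)
  have "laplace w (\<lambda>b t. G b (a # t)) = laplace w (\<lambda>b t. H b (a # t))"
    by (rule Cons.IH, rule Cons.prems) auto
  moreover have "G a w = H a w"
    by (rule Cons.prems) auto
  ultimately show ?case by simp
qed simp

lemma laplace_zero [simp]: "laplace w (\<lambda>b t. 0) = 0"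
  by (induction w) auto

lemma laplace_eq_zero:
  assumes "\<And>b t. b \<in> set w \<Longrightarrow> set t \<subseteq> set w \<Longrightarrow> length w = Suc (length t) \<Longrightarrow> G b t = 0"
  shows "laplace w G = 0"
  using laplace_cong[OF refl, of w G "\<lambda>b t. 0"] assms by simp

lemma laplace_add: "laplace w (\<lambda>b t. G b t + H b t) = laplace w G + laplace w H"
  by (induction w arbitrary: G H) (auto simp: algebra_simps)

lemma laplace_cmult: "laplace w (\<lambda>b t. c * G b t) = c * laplace w G"
  by (induction w arbitrary: G) (auto simp: algebra_simps)

lemma laplace_cmult_right: "laplace w (\<lambda>b t. G b t * c) = laplace w G * c"
  by (induction w arbitrary: G) (auto simp: algebra_simps)

lemma laplace_uminus: "laplace w (\<lambda>b t. - G b t) = - laplace w G"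
  by (induction w arbitrary: G) (auto simp: algebra_simps)

lemma laplace_diff: "laplace w (\<lambda>b t. G b t - H b t) = laplace w G - laplace w H"
  by (induction w arbitrary: G H) (auto simp: algebra_simps)

lemma laplace_append:
  "laplace (u @ v) G = laplace u (\<lambda>b t. G b (t @ v)) + (- 1) ^ length u * laplace v (\<lambda>b t. G b (u @ t))"
  by (induction u arbitrary: G) (auto simp: algebra_simps)

lemma laplace_map: "laplace (map h w) G = laplace w (\<lambda>b t. G (h b) (map h t))"
  by (induction w arbitrary: G) auto

lemma laplace_commute:
  "laplace u (\<lambda>a s. laplace v (\<lambda>b t. H a s b t)) = laplace v (\<lambda>b t. laplace u (\<lambda>a s. H a s b t))"
proof (induction u arbitrary: H)
  case (Cons c u)
  have "laplace (c # u) (\<lambda>a s. laplace v (\<lambda>b t. H a s b t))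
      = laplace v (\<lambda>b t. H c u b t) - laplace v (\<lambda>b t. laplace u (\<lambda>a s. H a (c # s) b t))"
    using Cons.IH[of "\<lambda>a s b t. H a (c # s) b t"] by simp
  also have "\<dots> = laplace v (\<lambda>b t. laplace (c # u) (\<lambda>a s. H a s b t))"
    by (simp add: laplace_diff)
  finally show ?case .
qed simp

text \<open>A pair of letters can be taken out in two orders, and the two orders come with opposite signs:
  the position of the later letter drops by one once the earlier one is gone. This is where all
  alternation of Pfaffians comes from.\<close>

lemma laplace_laplace:
  "laplace w (\<lambda>a s. laplace s (\<lambda>b t. H a b t)) = - laplace w (\<lambda>a s. laplace s (\<lambda>b t. H b a t))"
proof (induction w arbitrary: H)
  case (Cons c w)
  have "laplace w (\<lambda>a s. laplace s (\<lambda>b t. H a b (c # t)))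
      = - laplace w (\<lambda>a s. laplace s (\<lambda>b t. H b a (c # t)))"
    by (rule Cons.IH)
  then show ?case
    by (simp add: laplace_diff algebra_simps)
qed simp

section \<open>The Pfaffian of a word\<close>

text \<open>The rows and columns of the matrix are indexed by the letters of a word and its entries are given by
  one fixed form on the alphabet, so that Pfaffians of different submatrices and of bordered matrices
  are values of one function on different words.\<close>

function pf :: "('i \<Rightarrow> 'i \<Rightarrow> 'b::comm_ring_1) \<Rightarrow> 'i list \<Rightarrow> 'b" where
  "pf g [] = 1"
| "pf g (a # w) = laplace w (\<lambda>b t. g a b * pf g t)"
  by pat_completeness auto
termination by (relation "measure (\<lambda>(g, w). length w)") auto

lemma pf_cong:
  assumes "\<And>a b. a \<in> set w \<Longrightarrow> b \<in> set w \<Longrightarrow> g a b = h a b"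
  shows "pf g w = pf h w"
  using assms
proof (induction w rule: length_induct)
  case (1 w)
  show ?case
  proof (cases w)
    case (Cons a v)
    have "laplace v (\<lambda>b t. g a b * pf g t) = laplace v (\<lambda>b t. h a b * pf h t)"
    proof (rule laplace_cong[OF refl])
      fix b t assume bt: "b \<in> set v" "set t \<subseteq> set v" "length v = Suc (length t)"
      have "g a b = h a b" using 1(2) bt Cons by auto
      moreover have "pf g t = pf h t"
      proof (rule 1(1)[rule_format])
        show "length t < length w" using bt Cons by simp
        have "set t \<subseteq> set w" using bt Cons by auto
        then show "g a b = h a b" if "a \<in> set t" "b \<in> set t" for a b
          using that 1(2) by blast
      qed
      ultimately show "g a b * pf g t = h a b * pf h t" by simp
    qed
    then show ?thesis using Cons by simp
  qed simp
qed

lemma pf_map: "pf g (map h w) = pf (\<lambda>a b. g (h a) (h b)) w"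
proof (induction w rule: length_induct)
  case (1 w)
  show ?case
  proof (cases w)
    case (Cons a v)
    then show ?thesis
      using 1 by (auto simp: laplace_map intro!: laplace_cong)
  qed simp
qed

lemma pf_odd: "odd (length w) \<Longrightarrow> pf g w = 0"
proof (induction w rule: length_induct)
  case (1 w)
  show ?case
  proof (cases w)
    case (Cons a v)
    then show ?thesis
      using 1 by (auto intro!: laplace_eq_zero)
  qed (use 1 in simp)
qed

text \<open>Each term of the Pfaffian pairs off all letters, so every letter contributes its factor once.\<close>

lemma pf_scale: "pf (\<lambda>a b. c a * c b * g a b) w = prod_list (map c w) * pf g w"
proof (induction w rule: length_induct)
  case (1 w)
  have key: "laplace v (\<lambda>b t. c b * prod_list (map c t) * G b t) = prod_list (map c v) * laplace v G" for v and G
  proof (induction v arbitrary: G)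
    case (Cons a v)
    have "laplace v (\<lambda>b t. c b * prod_list (map c (a # t)) * G b (a # t))
        = c a * laplace v (\<lambda>b t. c b * prod_list (map c t) * G b (a # t))"
      unfolding laplace_cmult[symmetric] by (simp add: ac_simps)
    then show ?case
      using Cons[of "\<lambda>b t. G b (a # t)"] by (simp add: algebra_simps)
  qed simp
  show ?case
  proof (cases w)
    case (Cons a v)
    have "pf (\<lambda>a b. c a * c b * g a b) w
        = laplace v (\<lambda>b t. c a * (c b * prod_list (map c t) * (g a b * pf g t)))"
      using 1 Cons by (auto intro!: laplace_cong)
    also have "\<dots> = c a * prod_list (map c v) * laplace v (\<lambda>b t. g a b * pf g t)"
      by (simp only: laplace_cmult key) (simp only: mult.assoc)
    finally show ?thesis using Cons by simp
  qed simp
qed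

definition skew :: "('i \<Rightarrow> 'i \<Rightarrow> 'b::comm_ring_1) \<Rightarrow> bool" where
  "skew g \<longleftrightarrow> (\<forall>a b. g a b = - g b a)"

lemma skewD: "skew g \<Longrightarrow> g a b = - g b a"
  unfolding skew_def by blast

lemma skew_diag:
  fixes g :: "'i \<Rightarrow> 'i \<Rightarrow> 'b::field_char_0"
  assumes "skew g"
  shows "g a a = 0"
  using skewD[OF assms, of a a] by simp

text \<open>Expanding along both \<open>x\<close> and \<open>y\<close> leaves the term \<open>g x y\<close> and a double expansion, and both change
  sign when \<open>x\<close> and \<open>y\<close> are exchanged.\<close>

lemma pf_swap_front:
  assumes "skew g"
  shows "pf g (x # y # w) = - pf g (y # x # w)"
proof -
  have expand: "pf g (x # y # w) = g x y * pf g w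
      - laplace w (\<lambda>a s. laplace s (\<lambda>b t. g x a * (g y b * pf g t)))" for x y
    by (simp add: laplace_cmult)
  show ?thesis
    unfolding expand using laplace_laplace[of w "\<lambda>a b t. g x a * (g y b * pf g t)"] skewD[OF assms, of x y]
    by (simp add: ac_simps)
qed

text \<open>Taking out a letter other than \<open>x\<close> and \<open>y\<close> keeps these two adjacent; the two terms in which \<open>x\<close>
  or \<open>y\<close> is taken out are exchanged with opposite signs.\<close>

lemma laplace_swap:
  assumes "\<And>u t. length v + length w = Suc (length u + length t) \<Longrightarrow>
    F (u @ x # y # t) = - F (u @ y # x # t)"
  shows "laplace (v @ x # y # w) (\<lambda>(b::'i) t. f b * F t) = - laplace (v @ y # x # w) (\<lambda>b t. f b * F t)"
proof -
  have L: "laplace v (\<lambda>b t. f b * F (t @ x # y # w)) = - laplace v (\<lambda>b t. f b * F (t @ y # x # w))"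
    unfolding laplace_uminus[symmetric]
  proof (rule laplace_cong[OF refl])
    fix b t assume "length v = Suc (length (t :: 'i list))"
    then show "f b * F (t @ x # y # w) = - (f b * F (t @ y # x # w))"
      using assms(1)[of t w] by simp
  qed
  have R: "laplace w (\<lambda>b t. f b * F (v @ x # y # t)) = - laplace w (\<lambda>b t. f b * F (v @ y # x # t))"
    unfolding laplace_uminus[symmetric]
  proof (rule laplace_cong[OF refl])
    fix b t assume "length w = Suc (length (t :: 'i list))"
    then show "f b * F (v @ x # y # t) = - (f b * F (v @ y # x # t))"
      using assms(1)[of v t] by simp
  qed
  show ?thesis
    by (simp add: laplace_append L R algebra_simps)
qed

lemma pf_swap:
  assumes "skew g"
  shows "pf g (u @ x # y # w) = - pf g (u @ y # x # w)"
proof (induction "length u + length w" arbitrary: u w rule: less_induct)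
  case less
  show ?case
  proof (cases u)
    case Nil
    then show ?thesis using pf_swap_front[OF assms] by simp
  next
    case (Cons a v)
    have "laplace (v @ x # y # w) (\<lambda>b t. g a b * pf g t) = - laplace (v @ y # x # w) (\<lambda>b t. g a b * pf g t)"
      by (rule laplace_swap) (use less Cons in auto)
    then show ?thesis using Cons by simp
  qed
qed

lemma pf_move:
  assumes "skew g"
  shows "pf g (u @ v @ a # w) = (- 1) ^ length v * pf g (u @ a # v @ w)"
proof (induction v arbitrary: u)
  case (Cons b v)
  have "pf g (u @ (b # v) @ a # w) = (- 1) ^ length v * pf g (u @ b # a # v @ w)"
    using Cons[of "u @ [b]"] by simp
  then show ?case using pf_swap[OF assms, of u b a "v @ w"] by simp
qed simp

lemma pf_rotate:
  assumes "skew g"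
  shows "pf g (u @ v) = (- 1) ^ (length u * length v) * pf g (v @ u)"
proof (induction v arbitrary: u)
  case (Cons a v)
  have "pf g (u @ a # v) = (- 1) ^ length u * pf g (a # u @ v)"
    using pf_move[OF assms, of "[]" u a v] by simp
  also have "pf g (a # u @ v) = (- 1) ^ (length (a # u) * length v) * pf g (v @ a # u)"
    using Cons[of "a # u"] by simp
  also have "pf g (v @ a # u) = (- 1) ^ length v * pf g (a # v @ u)"
    using pf_move[OF assms, of "[]" v a u] by simp
  finally have main: "pf g (u @ a # v) = (- 1) ^ (length u + length (a # u) * length v + length v) * pf g (a # v @ u)"
    by (simp only: power_add mult.assoc)
  have "even (length u + length (a # u) * length v + length v) = even (length u * length (a # v))"
    by auto
  then have par: "(- 1 :: 'b) ^ (length u + length (a # u) * length v + length v) = (- 1) ^ (length u * length (a # v))"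
    by (simp only: minus_one_power_iff)
  show ?case using main unfolding par by (simp del: pf.simps)
qed simp

lemma pf_repeat:
  fixes g :: "'i \<Rightarrow> 'i \<Rightarrow> 'b::field_char_0"
  assumes "skew g" "a \<in> set w"
  shows "pf g (a # w) = 0"
proof -
  obtain u v where w: "w = u @ a # v" using split_list[OF assms(2)] by blast
  have "pf g (a # a # u @ v) = - pf g (a # a # u @ v)"
    using pf_swap_front[OF assms(1)] .
  then have "pf g (a # a # u @ v) = 0" by simp
  then show ?thesis
    using pf_move[OF assms(1), of "[a]" u a v] w by simp
qed

lemma pf_null_letter:
  assumes "a \<in> set w" "\<And>b. b \<in> set w \<Longrightarrow> g a b = 0" "skew g"
  shows "pf g w = 0"
proof -
  obtain u v where w: "w = u @ a # v" using split_list[OF assms(1)] by blast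
  have "pf g (a # u @ v) = 0"
    using assms(2) w by (auto intro!: laplace_eq_zero)
  then show ?thesis
    using pf_move[OF assms(3), of "[]" u a v] w by simp
qed

text \<open>No pair can join a letter of \<open>u\<close> to a letter of \<open>v\<close>.\<close>

lemma pf_block:
  assumes "\<And>a b. a \<in> set u \<Longrightarrow> b \<in> set v \<Longrightarrow> g a b = 0"
  shows "pf g (u @ v) = pf g u * pf g v"
  using assms
proof (induction u rule: length_induct)
  case (1 u)
  show ?case
  proof (cases u)
    case (Cons a s)
    have "laplace v (\<lambda>b t. g a b * pf g (s @ t)) = 0"
      using 1(2) Cons by (auto intro!: laplace_eq_zero)
    moreover have "laplace s (\<lambda>b t. g a b * pf g (t @ v)) = laplace s (\<lambda>b t. g a b * pf g t * pf g v)"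
    proof (rule laplace_cong[OF refl])
      fix b t assume bt: "b \<in> set s" "set t \<subseteq> set s" "length s = Suc (length t)"
      have "pf g (t @ v) = pf g t * pf g v"
        by (rule 1(1)[rule_format]) (use bt Cons 1(2) in auto)
      then show "g a b * pf g (t @ v) = g a b * pf g t * pf g v" by simp
    qed
    ultimately show ?thesis
      using Cons by (simp add: laplace_append laplace_cmult_right)
  qed simp
qed

section \<open>Rank one perturbation\<close>

text \<open>Up to sign, the form that is added to \<open>g\<close> is the wedge product of the linear forms \<open>g u\<close> and \<open>g v\<close>.
  Its square vanishes, so the Pfaffian is affine in it: at most one pair can be taken from the new
  form, and the terms with exactly one such pair are those of \<open>pf g (u # v # w)\<close>, in which \<open>u\<close> and \<open>v\<close>
  must be matched with letters of \<open>w\<close> because \<open>g u v = 0\<close>.\<close>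

lemma pf_perturb:
  fixes g h :: "'i \<Rightarrow> 'i \<Rightarrow> 'b::field_char_0"
  assumes "skew g" "g u v = 0"
    and "\<And>x z. x \<in> set w \<Longrightarrow> z \<in> set w \<Longrightarrow> h x z = g x z - g u x * g v z + g u z * g v x"
  shows "pf h w = pf g w + pf g (u # v # w)"
  using assms(3)
proof (induction w rule: length_induct)
  case (1 w)
  show ?case
  proof (cases w)
    case Nil
    then show ?thesis using assms(2) by simp
  next
    case (Cons x s)
    let ?F = "\<lambda>t. pf g t + pf g (u # v # t)"
    have vu: "g v u = 0" using skewD[OF assms(1), of v u] assms(2) by simp
    have uu: "g u u = 0" "g v v = 0" using skew_diag[OF assms(1)] by auto
    \<comment> \<open>The square of the added form vanishes: a second use of row \<open>u\<close> or \<open>v\<close> repeats a letter.\<close>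
    have row: "laplace s (\<lambda>b t. g c b * ?F t) = pf g (c # s)" if c: "c = u \<or> c = v" for c
    proof -
      have "pf g (c # u # v # s) = 0"
        by (rule pf_repeat[OF assms(1)]) (use c in auto)
      moreover have "g c u = 0" "g c v = 0"
        using vu uu assms(2) c by auto
      ultimately have "laplace s (\<lambda>b t. g c b * pf g (u # v # t)) = 0"
        unfolding pf.simps(2)[of g c "u # v # s"] by (simp del: pf.simps)
      then show ?thesis
        unfolding pf.simps(2)[of g c s] by (simp add: distrib_left laplace_add del: pf.simps)
    qed
    have "pf h w = laplace s (\<lambda>b t. h x b * pf h t)"
      using Cons by simp
    also have "\<dots> = laplace s (\<lambda>b t. (g x b - g u x * g v b + g u b * g v x) * ?F t)"
    proof (rule laplace_cong[OF refl])
      fix b t assume bt: "b \<in> set s" "set t \<subseteq> set s" "length s = Suc (length t)"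
      have "pf h t = ?F t"
        by (rule 1(1)[rule_format]) (use bt Cons 1(2) in auto)
      moreover have "h x b = g x b - g u x * g v b + g u b * g v x"
        using 1(2) bt Cons by auto
      ultimately show "h x b * pf h t = (g x b - g u x * g v b + g u b * g v x) * ?F t" by simp
    qed
    also have "\<dots> = laplace s (\<lambda>b t. g x b * ?F t + (- g u x) * (g v b * ?F t) + g v x * (g u b * ?F t))"
      by (simp add: algebra_simps)
    also have "\<dots> = laplace s (\<lambda>b t. g x b * ?F t) - g u x * pf g (v # s) + g v x * pf g (u # s)"
      by (simp only: laplace_add laplace_cmult row simp_thms) simp
    also have "laplace s (\<lambda>b t. g x b * ?F t) = pf g (x # s) + laplace s (\<lambda>b t. g x b * pf g (u # v # t))"
      unfolding pf.simps(2)[of g x s] by (simp add: distrib_left laplace_add del: pf.simps)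
    finally have A: "pf h w = pf g (x # s) + (laplace s (\<lambda>b t. g x b * pf g (u # v # t))
        - g u x * pf g (v # s) + g v x * pf g (u # s))" by simp
    have "pf g (u # v # x # s) = pf g (x # u # v # s)"
      using pf_move[OF assms(1), of "[]" "[u, v]" x s] by simp
    also have "\<dots> = g x u * pf g (v # s) - (g x v * pf g (u # s)) + laplace s (\<lambda>b t. g x b * pf g (u # v # t))"
      unfolding pf.simps(2)[of g x "u # v # s"] by (simp del: pf.simps)
    finally show ?thesis
      using A Cons skewD[OF assms(1), of x u] skewD[OF assms(1), of x v] by (simp del: pf.simps)
  qed
qed

section \<open>Quotients of Pfaffians\<close>

text \<open>Both sums expand to the same double sum over a letter \<open>a\<close> of \<open>u\<close> and a letter \<open>b\<close> of \<open>v\<close>, once with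
  the entry \<open>g a b\<close> and once with \<open>g b a\<close>.\<close>

lemma pf_exchange:
  assumes "skew g"
  shows "laplace u (\<lambda>a s. pf g s * pf g (a # v)) + laplace v (\<lambda>b t. pf g (b # u) * pf g t) = 0"
proof -
  have "laplace u (\<lambda>a s. pf g s * pf g (a # v))
      = laplace u (\<lambda>a s. laplace v (\<lambda>b t. g a b * pf g t * pf g s))"
    by (simp only: laplace_cmult_right pf.simps(2)) (simp only: mult.commute)
  also have "\<dots> = laplace v (\<lambda>b t. laplace u (\<lambda>a s. - (g b a * pf g s * pf g t)))"
    unfolding laplace_commute[of u v]
  proof (intro laplace_cong refl)
    show "g a b * pf g t * pf g s = - (g b a * pf g s * pf g t)" for a b s t
      using skewD[OF assms, of a b] by (simp add: mult_ac)
  qed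
  also have "\<dots> = - laplace v (\<lambda>b t. pf g (b # u) * pf g t)"
    by (simp add: laplace_uminus laplace_cmult_right)
  finally show ?thesis by simp
qed

text \<open>This is the exchange identity for the words \<open>\<alpha> x\<close> and \<open>\<alpha> w\<close>: taking out a letter of the common part
  \<open>\<alpha>\<close> repeats that letter in the other word, so only \<open>x\<close> and the letters of \<open>w\<close> contribute.\<close>

lemma pf_overlap:
  fixes g :: "'i \<Rightarrow> 'i \<Rightarrow> 'b::field_char_0"
  assumes "skew g" "even (length \<alpha>)"
  shows "pf g \<alpha> * pf g (\<alpha> @ x # w) = laplace w (\<lambda>b t. pf g (\<alpha> @ [x, b]) * pf g (\<alpha> @ t))"
proof -
  have "laplace (\<alpha> @ [x]) (\<lambda>a s. pf g s * pf g (a # \<alpha> @ w)) = pf g \<alpha> * pf g (x # \<alpha> @ w)"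
    unfolding laplace_append using assms
    by (subst laplace_eq_zero) (auto simp: pf_repeat[OF assms(1)] simp del: pf.simps)
  moreover have "laplace (\<alpha> @ w) (\<lambda>b t. pf g (b # \<alpha> @ [x]) * pf g t)
      = laplace w (\<lambda>b t. pf g (b # \<alpha> @ [x]) * pf g (\<alpha> @ t))"
    unfolding laplace_append using assms
    by (subst laplace_eq_zero) (auto simp: pf_repeat[OF assms(1)] simp del: pf.simps)
  ultimately have "pf g \<alpha> * pf g (x # \<alpha> @ w) = - laplace w (\<lambda>b t. pf g (b # \<alpha> @ [x]) * pf g (\<alpha> @ t))"
    using pf_exchange[OF assms(1), of "\<alpha> @ [x]" "\<alpha> @ w"] by (simp add: eq_neg_iff_add_eq_0)
  moreover have "pf g (x # \<alpha> @ w) = pf g (\<alpha> @ x # w)"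
    using pf_move[OF assms(1), of "[]" \<alpha> x w] assms(2) by simp
  moreover have "pf g (b # \<alpha> @ [x]) = - pf g (\<alpha> @ [x, b])" for b
    using pf_move[OF assms(1), of "[]" "\<alpha> @ [x]" b "[]"] assms(2) by simp
  ultimately show ?thesis by (simp add: laplace_uminus)
qed

text \<open>The Pfaffian analogue of Sylvester's determinant identity: dividing by \<open>pf g \<alpha>\<close> amounts to passing to
  the Schur complement of the block \<open>\<alpha>\<close>. By \<open>pf_overlap\<close> the quotients satisfy the recursion that
  defines the Pfaffian of the quotient form.\<close>

lemma pf_quotient:
  fixes g :: "'i \<Rightarrow> 'i \<Rightarrow> 'b::field_char_0"
  assumes "skew g" "even (length \<alpha>)" "pf g \<alpha> \<noteq> 0"
  shows "pf (\<lambda>a b. pf g (\<alpha> @ [a, b]) / pf g \<alpha>) w = pf g (\<alpha> @ w) / pf g \<alpha>"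
proof (induction w rule: length_induct)
  case (1 w)
  let ?h = "\<lambda>a b. pf g (\<alpha> @ [a, b]) / pf g \<alpha>"
  show ?case
  proof (cases w)
    case Nil
    then show ?thesis using assms(3) by simp
  next
    case (Cons x s)
    have "pf ?h w = laplace s (\<lambda>b t. inverse (pf g \<alpha> * pf g \<alpha>) * (pf g (\<alpha> @ [x, b]) * pf g (\<alpha> @ t)))"
      unfolding Cons pf.simps(2) using 1 Cons
      by (intro laplace_cong[OF refl]) (auto simp: divide_inverse mult_ac simp del: pf.simps)
    also have "\<dots> = inverse (pf g \<alpha> * pf g \<alpha>) * (pf g \<alpha> * pf g (\<alpha> @ w))"
      unfolding laplace_cmult pf_overlap[OF assms(1,2)] Cons ..
    also have "\<dots> = pf g (\<alpha> @ w) / pf g \<alpha>"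
      using assms(3) by (simp add: field_simps)
    finally show ?thesis .
  qed
qed

section \<open>Minor summation\<close>

text \<open>The alphabet is split into two sides, and the entries between the sides form the product of two
  matrices, with the pairs in \<open>D\<close> as the index of summation.\<close>

fun joined :: "('i \<Rightarrow> 'i \<Rightarrow> 'b::comm_ring_1) \<Rightarrow> ('j \<Rightarrow> 'j \<Rightarrow> 'b) \<Rightarrow> ('i \<times> 'j) list \<Rightarrow> 'i + 'j \<Rightarrow> 'i + 'j \<Rightarrow> 'b" where
  "joined g h D (Inl a) (Inl b) = g a b"
| "joined g h D (Inl a) (Inr c) = (\<Sum>(d, e)\<leftarrow>D. g a d * h e c)"
| "joined g h D (Inr c) (Inl a) = - (\<Sum>(d, e)\<leftarrow>D. g a d * h e c)"
| "joined g h D (Inr c) (Inr c') = h c c'"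

lemma skew_joined:
  assumes "skew g" "skew h"
  shows "skew (joined g h D)"
  unfolding skew_def
proof (intro allI)
  fix x z
  show "joined g h D x z = - joined g h D z x"
    by (cases x; cases z) (auto intro: skewD assms)
qed

text \<open>Each pair \<open>(d, e)\<close> in \<open>D\<close> contributes to the form the wedge product of the rows of \<open>d\<close> and \<open>e\<close>, so
  \<open>pf_perturb\<close> removes it at the price of a second term in which \<open>d\<close> joins the left word and \<open>e\<close> the
  right word. The vanishing on the letters of \<open>D\<close> provides \<open>g u v = 0\<close> in each step. When
  \<open>D\<close> is used up, the two sides are orthogonal and the Pfaffian is a product. The letters \<open>d\<close> pile up
  from left to right and the letters \<open>e\<close> from right to left, which is why the second word is reversed.\<close>

lemma pf_minor_summation:
  fixes g :: "'i \<Rightarrow> 'i \<Rightarrow> 'b::field_char_0" and h :: "'j \<Rightarrow> 'j \<Rightarrow> 'b"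
  assumes "skew g" "skew h"
    and "\<And>d d'. d \<in> fst ` set D \<Longrightarrow> d' \<in> fst ` set D \<Longrightarrow> g d d' = 0"
    and "\<And>e e'. e \<in> snd ` set D \<Longrightarrow> e' \<in> snd ` set D \<Longrightarrow> h e e' = 0"
  shows "pf (joined g h D) (map Inl u @ map Inr v)
    = (\<Sum>K\<leftarrow>subseqs D. pf g (u @ map fst K) * pf h (rev (map snd K) @ v))"
  using assms(3,4)
proof (induction D arbitrary: u v)
  case Nil
  have "pf (joined g h []) (map Inl u @ map Inr v) = pf (joined g h []) (map Inl u) * pf (joined g h []) (map Inr v)"
    by (rule pf_block) auto
  then show ?case by (simp add: pf_map)
next
  case (Cons de D)
  obtain d e where de: "de = (d, e)" by (cases de)
  let ?J = "joined g h D" and ?w = "map Inl u @ map Inr v"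
  have D0: "g d d' = 0" "h e' e = 0" if "(d', e') \<in> set D" for d' e'
  proof -
    have m: "d \<in> fst ` set (de # D)" "e \<in> snd ` set (de # D)" "d' \<in> fst ` set (de # D)" "e' \<in> snd ` set (de # D)"
      using that de by force+
    show "g d d' = 0" by (rule Cons.prems(1)[OF m(1,3)])
    show "h e' e = 0" by (rule Cons.prems(2)[OF m(4,2)])
  qed
  have L: "(\<Sum>(d', e')\<leftarrow>D. g d d' * h e' c) = 0" for c
    by (rule sum_list_neutral) (use D0 in auto)
  have R: "(\<Sum>(d', e')\<leftarrow>D. g a d' * h e' e) = 0" for a
    by (rule sum_list_neutral) (use D0 in auto)
  have sk: "skew ?J" by (rule skew_joined) fact+
  have "pf (joined g h (de # D)) ?w = pf ?J ?w + pf ?J (Inl d # Inr e # ?w)"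
  proof (rule pf_perturb[OF sk])
    show "?J (Inl d) (Inr e) = 0" using L by simp
    show "joined g h (de # D) x z = ?J x z - ?J (Inl d) x * ?J (Inr e) z + ?J (Inl d) z * ?J (Inr e) x" for x z
    proof (cases x; cases z)
      fix a c assume "x = Inl a" "z = Inr c"
      then show ?thesis using L R de skewD[OF assms(1), of a d] by simp
    next
      fix a c assume "x = Inr c" "z = Inl a"
      then show ?thesis using L R de skewD[OF assms(1), of a d] by simp
    qed (use L R de in auto)
  qed
  also have "pf ?J (Inl d # Inr e # ?w) = pf ?J (map Inl (u @ [d]) @ map Inr (e # v))"
    using pf_move[OF sk, of "[]" "map Inl u" "Inl d" "Inr e # map Inr v"]
      pf_move[OF sk, of "[Inl d]" "map Inl u" "Inr e" "map Inr v"]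
    by (simp del: pf.simps)
  finally have "pf (joined g h (de # D)) ?w
      = (\<Sum>K\<leftarrow>subseqs D. pf g (u @ map fst K) * pf h (rev (map snd K) @ v))
      + (\<Sum>K\<leftarrow>subseqs D. pf g ((u @ [d]) @ map fst K) * pf h (rev (map snd K) @ e # v))"
    using Cons.IH[of u v] Cons.IH[of "u @ [d]" "e # v"] Cons.prems by (simp del: pf.simps)
  then show ?case
    by (simp add: de Let_def o_def add.commute del: pf.simps)
qed

section \<open>Schur's Pfaffian\<close>

definition schur_form :: "'b::field \<Rightarrow> 'b \<Rightarrow> 'b" where
  "schur_form a b = (b - a) / (b + a)"

lemma skew_schur_form: "skew (schur_form :: 'b::field \<Rightarrow> 'b \<Rightarrow> 'b)"
  unfolding skew_def schur_form_def
proof (intro allI)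
  show "(b - a) / (b + a) = - ((a - b) / (a + b))" for a b :: 'b
    unfolding minus_divide_left by (simp add: add.commute)
qed

lemma Delta_Nil [simp]: "Delta [] = 1"
  by (simp add: Delta_def)

lemma Delta_Cons: "Delta (x # w) = prod_list (map (schur_form x) w) * Delta w"
proof -
  have "Delta (x # w) = (\<Prod>j<length w. schur_form x (w ! j) * (\<Prod>i<j. schur_form (w ! i) (w ! j)))"
    unfolding Delta_def length_Cons prod.lessThan_Suc_shift by (simp add: schur_form_def)
  also have "\<dots> = (\<Prod>j<length w. schur_form x (w ! j)) * Delta w"
    unfolding prod.distrib by (simp add: Delta_def schur_form_def)
  also have "(\<Prod>j<length w. schur_form x (w ! j)) = prod_list (map (schur_form x) w)"
    by (simp add: prod.list_conv_set_nth atLeast0LessThan)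
  finally show ?thesis .
qed

lemma Delta_append:
  "Delta (u @ v) = Delta u * Delta v * prod_list (map (\<lambda>b. prod_list (map (\<lambda>a. schur_form a b) u)) v)"
proof (induction u)
  case (Cons a u)
  have "prod_list (map (\<lambda>b. schur_form a b * F b) v) = prod_list (map (schur_form a) v) * prod_list (map F v)" for F
    by (induction v) (auto simp: algebra_simps)
  then show ?case using Cons by (simp add: Delta_Cons)
qed (simp add: map_replicate_const)

text \<open>Schur's Pfaffian for four points, the only case that is checked by computing in the field.\<close>

lemma schur_form_four:
  fixes a b c d :: "'b::field"
  assumes "a + b \<noteq> 0" "a + c \<noteq> 0" "a + d \<noteq> 0" "b + c \<noteq> 0" "b + d \<noteq> 0" "c + d \<noteq> 0"
  shows "schur_form a b * schur_form c d - schur_form a c * schur_form b d + schur_form a d * schur_form b c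
    = schur_form a b * (schur_form a c * schur_form b c) * (schur_form a d * schur_form b d) * schur_form c d"
proof -
  have "b + a \<noteq> 0" "c + a \<noteq> 0" "d + a \<noteq> 0" "c + b \<noteq> 0" "d + b \<noteq> 0" "d + c \<noteq> 0"
    using assms by (simp_all add: add.commute)
  then show ?thesis
    unfolding schur_form_def by (simp add: divide_simps) (simp add: algebra_simps)
qed

text \<open>Divide by the Pfaffian of the first two points. By the case of four points the quotient form is again
  the Schur form up to a factor for each point, so the claim for two points less applies.\<close>

lemma schur_pfaffian:
  fixes xs :: "'b::field_char_0 list"
  assumes "distinct xs" "\<And>a b. a \<in> set xs \<Longrightarrow> b \<in> set xs \<Longrightarrow> a \<noteq> b \<Longrightarrow> a + b \<noteq> 0" "even (length xs)"
  shows "pf schur_form xs = Delta xs"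
  using assms
proof (induction xs rule: induct_list012)
  case (3 x y w)
  let ?q = schur_form
  let ?c = "\<lambda>a. ?q x a * ?q y a"
  have xy: "?q x y \<noteq> 0"
    using 3(3,4) unfolding schur_form_def by (auto simp: add.commute)
  have two: "pf ?q [x, y] = ?q x y" by simp
  have "pf ?q ([x, y] @ w) = ?q x y * pf (\<lambda>a b. pf ?q ([x, y] @ [a, b]) / ?q x y) w"
    using pf_quotient[OF skew_schur_form, of "[x, y]" w] xy unfolding two by simp
  also have "pf (\<lambda>a b. pf ?q ([x, y] @ [a, b]) / ?q x y) w = pf (\<lambda>a b. ?c a * ?c b * ?q a b) w"
  proof (rule pf_cong)
    fix a b assume ab: "a \<in> set w" "b \<in> set w"
    show "pf ?q ([x, y] @ [a, b]) / ?q x y = ?c a * ?c b * ?q a b"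
    proof (cases "a = b")
      case True
      then show ?thesis using skew_diag[OF skew_schur_form, of a] by simp
    next
      case False
      have "x + y \<noteq> 0" "x + a \<noteq> 0" "x + b \<noteq> 0" "y + a \<noteq> 0" "y + b \<noteq> 0" "a + b \<noteq> 0"
        using ab False 3(3,4) by auto
      from schur_form_four[OF this] show ?thesis using xy by (simp add: field_simps)
    qed
  qed
  also have "\<dots> = prod_list (map ?c w) * Delta w"
    unfolding pf_scale using 3 by simp
  also have "prod_list (map ?c w) = prod_list (map (?q x) w) * prod_list (map (?q y) w)"
    by (induction w) (auto simp: algebra_simps)
  finally show ?case by (simp add: Delta_Cons)
qed simp_all

section \<open>The Pfaffian of a matrix\<close>

lemma laplace_sum:
  "laplace w G = (\<Sum>i<length w. (- 1) ^ i * G (w ! i) (take i w @ drop (Suc i) w))"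
proof (induction w arbitrary: G)
  case (Cons a w)
  show ?case
    by (simp add: Cons sum.lessThan_Suc_shift sum_negf del: sum.lessThan_Suc)
qed simp

lemma pf_transpose_letters:
  assumes "skew g"
  shows "pf g (u @ x # v @ y # w) = - pf g (u @ y # v @ x # w)"
  using pf_move[OF assms, of "u @ [x]" v y w] pf_move[OF assms, of "u @ [y]" v x w]
    pf_swap[OF assms, of u x y "v @ w"] by simp

lemma upt_split:
  assumes ab: "a < b" "b < n"
  shows "[0..<n] = [0..<a] @ a # [Suc a..<b] @ b # [Suc b..<n]"
proof -
  have split: "[i..<n] = [i..<j] @ j # [Suc j..<n]" if "i \<le> j" "j < n" for i j
    using upt_add_eq_append[of i j "n - j"] upt_conv_Cons[of j n] that by simp
  show ?thesis
    using split[of 0 a] split[of "Suc a" b] ab by simp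
qed

lemma pf_comp_transpose:
  assumes "skew g" "a < b" "b < n"
  shows "pf g (map (w \<circ> Transposition.transpose a b) [0..<n]) = - pf g (map w [0..<n])"
proof -
  have "map (w \<circ> Transposition.transpose a b) [0..<n]
      = map w [0..<a] @ w b # map w [Suc a..<b] @ w a # map w [Suc b..<n]"
    unfolding upt_split[OF assms(2,3)] using assms(2,3) by (auto simp: Transposition.transpose_def)
  moreover have "map w [0..<n] = map w [0..<a] @ w a # map w [Suc a..<b] @ w b # map w [Suc b..<n]"
    unfolding upt_split[OF assms(2,3)] by simp
  ultimately show ?thesis
    by (simp only: pf_transpose_letters[OF assms(1), of "map w [0..<a]" "w b"])
qed

text \<open>Quantifying over \<open>w\<close> allows the permutation to be built from transpositions that act next to \<open>w\<close>.\<close>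

lemma pf_permute:
  assumes "skew g" "\<sigma> permutes {0..<n}"
  shows "pf g (map (w \<circ> \<sigma>) [0..<n]) = signof \<sigma> * pf g (map w [0..<n])"
  using assms(2) finite_atLeastLessThan
proof (induction arbitrary: w rule: permutes_induct)
  case (swap a b p)
  let ?t = "Transposition.transpose a b"
  have "pf g (map (w \<circ> (?t \<circ> p)) [0..<n]) = signof p * pf g (map (w \<circ> ?t) [0..<n])"
    using swap.IH[of "w \<circ> ?t"] by (simp only: comp_assoc)
  also have "pf g (map (w \<circ> ?t) [0..<n]) = - pf g (map w [0..<n])"
  proof (cases "a < b")
    case True
    then show ?thesis using pf_comp_transpose[OF assms(1)] swap by simp
  next
    case False
    then have "b < a" "a < n" using swap by auto
    then show ?thesis
      using pf_comp_transpose[OF assms(1), of b a n w] by (simp add: transpose_commute)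
  qed
  also have "signof p * (- pf g (map w [0..<n])) = signof (?t \<circ> p) * pf g (map w [0..<n])"
  proof -
    have "permutation p" using swap.hyps permutation_permutes by blast
    then show ?thesis
      using swap.hyps by (simp add: sign_compose permutation_swap_id sign_swap_id)
  qed
  finally show ?case .
qed auto

text \<open>The first \<open>k\<close> pairs of the matching are already written as a product, and the Pfaffian of the
  remaining letters is expanded along its first letter. After summation over all permutations the
  terms of this expansion are equal: composition with a transposition moves the partner at place \<open>j\<close> to
  the place \<open>2 * k + 1\<close>, and the sign of the expansion is cancelled by that of the transposition and that
  of moving the displaced letter back into order.\<close>

lemma pf_matching_step:
  fixes g :: "nat \<Rightarrow> nat \<Rightarrow> 'b::field_char_0"
  assumes "skew g" "k < m"
  shows "(\<Sum>\<sigma> | \<sigma> permutes {0..<2 * m}. signof \<sigma> * (\<Prod>i=0..<k. g (\<sigma> (2 * i)) (\<sigma> (2 * i + 1))) * pf g (map \<sigma> [2 * k..<2 * m]))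
    = of_nat (2 * (m - Suc k) + 1) * (\<Sum>\<sigma> | \<sigma> permutes {0..<2 * m}. signof \<sigma> * (\<Prod>i=0..<Suc k. g (\<sigma> (2 * i)) (\<sigma> (2 * i + 1))) * pf g (map \<sigma> [2 * Suc k..<2 * m]))"
proof -
  let ?S = "{\<sigma>. \<sigma> permutes {0..<2 * m}}" and ?a = "2 * k + 1"
  let ?P = "\<lambda>\<sigma>. \<Prod>i=0..<k. g (\<sigma> (2 * i)) (\<sigma> (2 * i + 1))"
  define T where "T = (\<lambda>j \<sigma>. signof \<sigma> * ?P \<sigma> * ((- 1) ^ (j - ?a) * (g (\<sigma> (2 * k)) (\<sigma> j)
    * pf g (map \<sigma> ([?a..<j] @ [Suc j..<2 * m])))))"
  define U where "U = (\<lambda>\<sigma>. signof \<sigma> * (\<Prod>i=0..<Suc k. g (\<sigma> (2 * i)) (\<sigma> (2 * i + 1)))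
    * pf g (map \<sigma> [2 * Suc k..<2 * m]))"
  have step: "(\<Sum>\<sigma>\<in>?S. T j \<sigma>) = (\<Sum>\<sigma>\<in>?S. U \<sigma>)" if j: "?a \<le> j" "j < 2 * m" for j
  proof (cases "j = ?a")
    case True
    then show ?thesis by (simp add: T_def U_def mult_ac)
  next
    case False
    then have aj: "?a < j" using j by simp
    let ?t = "Transposition.transpose ?a j"
    have t: "?t permutes {0..<2 * m}"
      using j by (intro permutes_swap_id) auto
    have "T j (\<sigma> \<circ> ?t) = U \<sigma>" if \<sigma>: "\<sigma> permutes {0..<2 * m}" for \<sigma>
    proof -
      have "sign (\<sigma> \<circ> ?t) = sign \<sigma> * sign ?t"
        using \<sigma> t permutation_permutes by (intro sign_compose) blast+
      then have s: "(signof (\<sigma> \<circ> ?t) :: 'b) = - signof \<sigma>"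
        using aj by (simp add: sign_swap_id)
      have p: "?P (\<sigma> \<circ> ?t) = ?P \<sigma>"
        using aj by (intro prod.cong) (auto simp: Transposition.transpose_def)
      have u1: "[?a..<j] = ?a # [Suc ?a..<j]"
        using aj by (rule upt_conv_Cons)
      have u2: "[2 * Suc k..<2 * m] = [Suc ?a..<j] @ j # [Suc j..<2 * m]"
        using upt_add_eq_append[of "Suc ?a" j "2 * m - j"] upt_conv_Cons[of j "2 * m"] aj j by simp
      have "map (\<sigma> \<circ> ?t) ([?a..<j] @ [Suc j..<2 * m]) = \<sigma> j # map \<sigma> [Suc ?a..<j] @ map \<sigma> [Suc j..<2 * m]"
        unfolding u1 using aj by (auto simp: Transposition.transpose_def)
      then have "pf g (map \<sigma> [2 * Suc k..<2 * m])
          = (- 1) ^ (j - Suc ?a) * pf g (map (\<sigma> \<circ> ?t) ([?a..<j] @ [Suc j..<2 * m]))"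
        unfolding u2 using pf_move[OF assms(1), of "[]" "map \<sigma> [Suc ?a..<j]" "\<sigma> j" "map \<sigma> [Suc j..<2 * m]"]
        by (simp del: pf.simps)
      moreover have "j - ?a = Suc (j - Suc ?a)" using aj by simp
      moreover have "(\<sigma> \<circ> ?t) (2 * k) = \<sigma> (2 * k)" "(\<sigma> \<circ> ?t) j = \<sigma> ?a"
        using aj by (auto simp: Transposition.transpose_def)
      ultimately show ?thesis
        unfolding T_def U_def s p by (simp add: mult_ac del: pf.simps)
    qed
    then have "(\<Sum>\<sigma>\<in>?S. T j (\<sigma> \<circ> ?t)) = (\<Sum>\<sigma>\<in>?S. U \<sigma>)"
      by (intro sum.cong) auto
    moreover have "(\<Sum>\<sigma>\<in>?S. T j \<sigma>) = (\<Sum>\<sigma>\<in>?S. T j (\<sigma> \<circ> ?t))"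
      by (rule sum_permutations_compose_right[OF t]) 
    ultimately show ?thesis by simp
  qed
  have expand: "signof \<sigma> * ?P \<sigma> * pf g (map \<sigma> [2 * k..<2 * m]) = (\<Sum>j=?a..<2 * m. T j \<sigma>)" for \<sigma>
  proof -
    have u: "[2 * k..<2 * m] = 2 * k # [?a..<2 * m]"
      using upt_conv_Cons[of "2 * k" "2 * m"] assms(2) by simp
    have "pf g (map \<sigma> [2 * k..<2 * m]) = (\<Sum>i<2 * m - ?a. (- 1) ^ i * (g (\<sigma> (2 * k)) (\<sigma> (?a + i))
        * pf g (map \<sigma> ([?a..<?a + i] @ [Suc (?a + i)..<2 * m]))))"
      unfolding u list.map pf.simps(2) laplace_sum
      by (intro sum.cong) (auto simp: take_map drop_map simp flip: map_append simp del: pf.simps map_append)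
    also have "\<dots> = (\<Sum>j=?a..<2 * m. (- 1) ^ (j - ?a) * (g (\<sigma> (2 * k)) (\<sigma> j)
        * pf g (map \<sigma> ([?a..<j] @ [Suc j..<2 * m]))))"
      by (rule sum.reindex_bij_witness[of _ "\<lambda>j. j - ?a" "\<lambda>i. ?a + i"]) auto
    finally show ?thesis
      by (simp only: T_def sum_distrib_left)
  qed
  have "(\<Sum>\<sigma>\<in>?S. signof \<sigma> * ?P \<sigma> * pf g (map \<sigma> [2 * k..<2 * m])) = (\<Sum>j=?a..<2 * m. \<Sum>\<sigma>\<in>?S. T j \<sigma>)"
    unfolding expand by (rule sum.swap)
  also have "\<dots> = (\<Sum>j=?a..<2 * m. \<Sum>\<sigma>\<in>?S. U \<sigma>)"
    by (intro sum.cong step) auto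
  also have "\<dots> = of_nat (2 * (m - Suc k) + 1) * (\<Sum>\<sigma>\<in>?S. U \<sigma>)"
  proof -
    have "2 * m - ?a = 2 * (m - Suc k) + 1" using assms(2) by simp
    then show ?thesis by (simp del: of_nat_add of_nat_mult)
  qed
  finally show ?thesis unfolding U_def .
qed

lemma fact_double: "(fact (2 * m) :: 'b::field_char_0) = 2 ^ m * fact m * (\<Prod>k<m. of_nat (2 * k + 1))"
proof (induction m)
  case (Suc m)
  have "(fact (2 * Suc m) :: 'b) = of_nat (2 * m + 2) * (of_nat (2 * m + 1) * fact (2 * m))"
    by (simp add: algebra_simps)
  then show ?case using Suc by (simp add: algebra_simps)
qed simp


text \<open>The signed sum of the antisymmetric function \<open>pf\<close> over all permutations is \<open>(2 m)!\<close> times its value, while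
  splitting off one pair after the other gives \<open>(2 m - 1) (2 m - 3) \<cdots> 1\<close> times the sum over
  permutations. The quotient of the two factors is \<open>2\<^sup>m m!\<close>.\<close>

lemma pf_as_permutation_sum:
  fixes g :: "nat \<Rightarrow> nat \<Rightarrow> 'b::field_char_0"
  assumes "skew g"
  shows "(\<Sum>\<sigma> | \<sigma> permutes {0..<2 * m}. signof \<sigma> * (\<Prod>i=0..<m. g (\<sigma> (2 * i)) (\<sigma> (2 * i + 1))))
    = of_nat (2 ^ m * fact m) * pf g [0..<2 * m]"
proof -
  define S where "S = (\<lambda>k. \<Sum>\<sigma> | \<sigma> permutes {0..<2 * m}.
    signof \<sigma> * (\<Prod>i=0..<k. g (\<sigma> (2 * i)) (\<sigma> (2 * i + 1))) * pf g (map \<sigma> [2 * k..<2 * m]))"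
  have "signof \<sigma> * pf g (map \<sigma> [0..<2 * m]) = pf g [0..<2 * m]" if "\<sigma> permutes {0..<2 * m}" for \<sigma>
    using pf_permute[OF assms that, of id] by (simp add: mult.assoc[symmetric] flip: of_int_mult)
  then have "S 0 = (\<Sum>\<sigma> | \<sigma> permutes {0..<2 * m}. pf g [0..<2 * m])"
    unfolding S_def by (intro sum.cong) (auto simp del: pf.simps)
  then have S0: "S 0 = fact (2 * m) * pf g [0..<2 * m]"
    by (simp add: card_permutations)
  have iter: "S 0 = (\<Prod>i<k. of_nat (2 * (m - Suc i) + 1)) * S k" if "k \<le> m" for k
    using that
  proof (induction k)
    case (Suc k)
    then show ?case
      using pf_matching_step[OF assms, of k m] unfolding S_def by (simp add: mult.assoc del: of_nat_add of_nat_mult)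
  qed simp
  have "(\<Prod>i<m. of_nat (2 * (m - Suc i) + 1) :: 'b) = (\<Prod>i<m. of_nat (2 * i + 1))"
    by (rule prod.nat_diff_reindex)
  then have "(\<Prod>i<m. of_nat (2 * i + 1) :: 'b) * S m = (\<Prod>i<m. of_nat (2 * i + 1)) * (2 ^ m * fact m * pf g [0..<2 * m])"
    using iter[of m] unfolding S0 fact_double by (simp only: order_refl simp_thms) (simp only: mult_ac)
  moreover have "(\<Prod>i<m. of_nat (2 * i + 1) :: 'b) \<noteq> 0"
    by (simp only: prod_zero_iff finite_lessThan of_nat_eq_0_iff) simp
  ultimately have "S m = 2 ^ m * fact m * pf g [0..<2 * m]"
    by (rule mult_left_cancel[THEN iffD1, rotated])
  then show ?thesis by (simp add: S_def)
qed

lemma pfaffian_eq_pf: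
  fixes A :: "'b::field_char_0 mat"
  assumes "dim_row A = n" "even n"
    and "\<And>i j. i < n \<Longrightarrow> j < n \<Longrightarrow> A $$ (i, j) = - A $$ (j, i)"
  shows "pfaffian A = pf (\<lambda>i j. A $$ (i, j)) [0..<n]"
proof -
  obtain m where m: "n = 2 * m" using assms(2) by blast
  define g where "g = (\<lambda>i j. if i < n \<and> j < n then A $$ (i, j) else 0)"
  have "skew g" unfolding skew_def
  proof (intro allI)
    show "g i j = - g j i" for i j
      using assms(3)[of i j] by (cases "i < n \<and> j < n") (auto simp: g_def)
  qed
  note sum = pf_as_permutation_sum[OF this, of m]
  have "(\<Sum>\<sigma> | \<sigma> permutes {0..<2 * m}. signof \<sigma> * (\<Prod>i=0..<m. A $$ (\<sigma> (2 * i), \<sigma> (2 * i + 1))))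
    = (\<Sum>\<sigma> | \<sigma> permutes {0..<2 * m}. signof \<sigma> * (\<Prod>i=0..<m. g (\<sigma> (2 * i)) (\<sigma> (2 * i + 1))))"
  proof (intro sum.cong refl arg_cong2[where f = times] prod.cong)
    fix \<sigma> i assume "\<sigma> \<in> {\<sigma>. \<sigma> permutes {0..<2 * m}}" "i \<in> {0..<m}"
    then have "\<sigma> (2 * i) < n" "\<sigma> (2 * i + 1) < n"
      using permutes_in_image[of \<sigma> "{0..<2 * m}" "2 * i"] permutes_in_image[of \<sigma> "{0..<2 * m}" "2 * i + 1"] m by auto
    then show "A $$ (\<sigma> (2 * i), \<sigma> (2 * i + 1)) = g (\<sigma> (2 * i)) (\<sigma> (2 * i + 1))"
      by (simp add: g_def)
  qed
  moreover have "pf g [0..<n] = pf (\<lambda>i j. A $$ (i, j)) [0..<n]"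
    by (rule pf_cong) (auto simp: g_def)
  ultimately show ?thesis
    using sum m assms(1) by (simp add: pfaffian_def Let_def del: pf.simps)
qed

section \<open>Generalized P-functions as Pfaffians of words\<close>

text \<open>Besides a point \<open>a\<close> and the \<open>r\<close>-th polynomial of the sequence there is one auxiliary letter. It
  pairs with points as the point \<open>0\<close> would, since \<open>schur_form 0 b = 1\<close> for \<open>b \<noteq> 0\<close>, but on it the
  polynomial \<open>f 0\<close> takes the value \<open>1\<close> and all others the value \<open>0\<close>. It completes an odd number of points
  to an even one, so that the matrix of the points becomes invertible and both parities can be
  treated together.\<close>

datatype 'b letter = Inf | Pt 'b | Fn nat

fun form :: "(nat \<Rightarrow> 'b::field poly) \<Rightarrow> 'b letter \<Rightarrow> 'b letter \<Rightarrow> 'b" where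
  "form f (Pt a) (Pt b) = schur_form a b"
| "form f (Pt a) (Fn r) = poly (f r) a"
| "form f (Fn r) (Pt a) = - poly (f r) a"
| "form f (Fn r) (Fn s) = 0"
| "form f Inf Inf = 0"
| "form f Inf (Pt a) = 1"
| "form f (Pt a) Inf = - 1"
| "form f Inf (Fn r) = (if r = 0 then 1 else 0)"
| "form f (Fn r) Inf = - (if r = 0 then 1 else 0)"

lemma skew_form: "skew (form f)"
  unfolding skew_def
proof (intro allI)
  show "form f a b = - form f b a" for a b
    using skewD[OF skew_schur_form] by (cases a; cases b) auto
qed

text \<open>The word of points, completed to even length.\<close>

definition pts :: "'b list \<Rightarrow> 'b letter list" where
  "pts xs = (if even (length xs) then [] else [Inf]) @ map Pt xs"

lemma even_length_pts: "even (length (pts xs))"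
  by (simp add: pts_def)

text \<open>The case \<open>a = b\<close> of the second condition says that \<open>0\<close> is not among the points, as \<open>2\<close> is invertible
  in the fields considered.\<close>

definition generic :: "'b::field list \<Rightarrow> bool" where
  "generic xs \<longleftrightarrow> distinct xs \<and> (\<forall>a\<in>set xs. \<forall>b\<in>set xs. a + b \<noteq> 0)"

lemma generic_append: "generic (xs @ ys) \<Longrightarrow> generic xs" "generic (xs @ ys) \<Longrightarrow> generic ys"
  by (auto simp: generic_def)

lemma generic_mono: "generic xs \<Longrightarrow> set ys \<subseteq> set xs \<Longrightarrow> distinct ys \<Longrightarrow> generic ys"
  by (auto simp: generic_def)

lemma generic_nonzero: "generic xs \<Longrightarrow> a \<in> set xs \<Longrightarrow> a \<noteq> 0"
  by (metis add.right_neutral generic_def)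

lemma prod_list_neq_0: "(\<And>a. a \<in> set xs \<Longrightarrow> F a \<noteq> (0 :: 'b::field)) \<Longrightarrow> prod_list (map F xs) \<noteq> 0"
  by (induction xs) auto

lemma Delta_neq_0:
  assumes "generic xs"
  shows "Delta xs \<noteq> 0"
  using assms
proof (induction xs)
  case (Cons a xs)
  have "schur_form a b \<noteq> 0" if "b \<in> set xs" for b
    using Cons.prems that by (auto simp: generic_def schur_form_def)
  then have "prod_list (map (schur_form a) xs) \<noteq> 0" by (rule prod_list_neq_0)
  moreover have "Delta xs \<noteq> 0"
    using Cons.IH generic_append(2)[of "[a]" xs] Cons.prems by simp
  ultimately show ?case by (simp add: Delta_Cons)
qed simp

text \<open>For an odd number of points, \<open>Inf\<close> pairs with the nonzero points like the point \<open>0\<close>, since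
  \<open>schur_form 0 a = 1\<close>; so this is Schur's Pfaffian with \<open>0\<close> as an additional point.\<close>

lemma pf_pts:
  fixes xs :: "'b::field_char_0 list"
  assumes "generic xs"
  shows "pf (form f) (pts xs) = Delta xs"
proof (cases "even (length xs)")
  case True
  then have "pf (form f) (pts xs) = pf schur_form xs"
    by (simp add: pts_def pf_map)
  then show ?thesis
    using schur_pfaffian[of xs] assms True by (simp add: generic_def)
next
  case False
  let ?h = "\<lambda>a. if a = 0 then Inf else Pt a"
  have nz: "a \<noteq> 0" if "a \<in> set xs" for a using generic_nonzero[OF assms that] .
  have "pts xs = map ?h (0 # xs)"
    using False nz by (auto simp: pts_def)
  then have "pf (form f) (pts xs) = pf (\<lambda>a b. form f (?h a) (?h b)) (0 # xs)"
    by (simp only: pf_map)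
  also have "\<dots> = pf schur_form (0 # xs)"
    by (rule pf_cong) (auto simp: schur_form_def)
  also have "\<dots> = Delta (0 # xs)"
    by (rule schur_pfaffian) (use assms False nz in \<open>auto simp: generic_def\<close>)
  also have "\<dots> = Delta xs"
  proof -
    have "map (schur_form 0) xs = map (\<lambda>_. 1) xs"
      using nz by (auto simp: schur_form_def)
    then have "prod_list (map (schur_form 0) xs) = 1"
      by (simp add: map_replicate_const)
    then show ?thesis by (simp add: Delta_Cons)
  qed
  finally show ?thesis .
qed

lemma pfaffian_bordered:
  fixes g :: "'i \<Rightarrow> 'i \<Rightarrow> 'b::field_char_0"
  assumes "skew g" "even (length u + length v)" "\<And>a b. a \<in> set v \<Longrightarrow> b \<in> set v \<Longrightarrow> g a b = 0"
  shows "pfaffian (bordered (mat (length u) (length u) (\<lambda>(i, j). g (u ! i) (u ! j)))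
      (mat (length u) (length v) (\<lambda>(i, j). g (u ! i) (v ! j)))) = pf g (u @ v)"
    (is "pfaffian ?B = _")
proof -
  let ?n = "length u + length v"
  have entry: "?B $$ (i, j) = g ((u @ v) ! i) ((u @ v) ! j)" if "i < ?n" "j < ?n" for i j
  proof (cases "i < length u"; cases "j < length u")
    assume "\<not> i < length u" "j < length u"
    then show ?thesis using that skewD[OF assms(1), of "v ! (i - length u)" "u ! j"]
      by (simp add: bordered_def nth_append)
  next
    assume "\<not> i < length u" "\<not> j < length u"
    then show ?thesis using that assms(3)[of "v ! (i - length u)" "v ! (j - length u)"]
      by (simp add: bordered_def nth_append)
  qed (use that in \<open>simp_all add: bordered_def nth_append\<close>)
  have "pfaffian ?B = pf (\<lambda>i j. ?B $$ (i, j)) [0..<?n]"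
  proof (rule pfaffian_eq_pf)
    show "?B $$ (i, j) = - ?B $$ (j, i)" if "i < ?n" "j < ?n" for i j
      unfolding entry[OF that] entry[OF that(2,1)] by (rule skewD[OF assms(1)])
  qed (use assms(2) in \<open>simp_all add: bordered_def\<close>)
  also have "\<dots> = pf (\<lambda>i j. g ((u @ v) ! i) ((u @ v) ! j)) [0..<?n]"
    by (rule pf_cong) (use entry in auto)
  also have "\<dots> = pf g (map (\<lambda>i. (u @ v) ! i) [0..<?n])"
    by (simp only: pf_map)
  also have "map (\<lambda>i. (u @ v) ! i) [0..<?n] = u @ v"
    using map_nth[of "u @ v"] by simp
  finally show ?thesis .
qed

lemma P_fun_eq_pf:
  fixes xs :: "'b::field_char_0 list"
  shows "P_fun f \<alpha> xs = pf (form f) (map Pt xs @ map Fn (pad (length xs) \<alpha>)) / Delta xs"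
proof -
  let ?u = "map Pt xs" and ?v = "map Fn (pad (length xs) \<alpha>) :: 'b letter list"
  have A: "A_mat xs = mat (length ?u) (length ?u) (\<lambda>(i, j). form f (?u ! i) (?u ! j))"
    by (rule eq_matI) (auto simp: A_mat_def schur_form_def)
  have V: "V_mat f (pad (length xs) \<alpha>) xs = mat (length ?u) (length ?v) (\<lambda>(i, j). form f (?u ! i) (?v ! j))"
    by (rule eq_matI) (auto simp: V_mat_def)
  have "even (length ?u + length ?v)"
    by (auto simp: pad_def)
  then show ?thesis
    unfolding P_fun_def A V
    by (subst pfaffian_bordered[OF skew_form]) (auto simp del: length_map)
qed

text \<open>On points and on polynomials other than \<open>f\<^sub>0\<close>, the letter \<open>Inf\<close> is the negative of \<open>f\<^sub>0\<close>, and
  moving it to the other end of a word of odd length costs one more sign.\<close>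

lemma pf_Inf_odd:
  fixes f :: "nat \<Rightarrow> 'b::field_char_0 poly"
  assumes "\<And>b. b \<in> set w \<Longrightarrow> form f Inf b = - form f (Fn 0) b" "odd (length w)"
  shows "pf (form f) (Inf # w) = pf (form f) (w @ [Fn 0])"
proof -
  have "pf (form f) (Inf # w) = - pf (form f) (Fn 0 # w)"
    unfolding pf.simps(2) laplace_uminus[symmetric]
    by (rule laplace_cong[OF refl]) (use assms(1) in simp)
  also have "\<dots> = pf (form f) (w @ [Fn 0])"
    using pf_move[OF skew_form, of f "[]" w "Fn 0" "[]"] assms(2) by simp
  finally show ?thesis .
qed

text \<open>Adding the row of \<open>Fn 0\<close> to the row of \<open>Inf\<close> leaves only the entry \<open>form f Inf (Fn 0) = 1\<close>.\<close>

lemma pf_Inf_even: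
  fixes f :: "nat \<Rightarrow> 'b::field_char_0 poly"
  assumes "\<And>b. b \<in> set w \<Longrightarrow> form f Inf b = - form f (Fn 0) b" "even (length w)"
  shows "pf (form f) (Inf # w @ [Fn 0]) = pf (form f) w"
proof -
  let ?g = "form f"
  have "pf ?g (Fn 0 # Fn 0 # w) = 0"
    by (rule pf_repeat[OF skew_form]) simp
  then have null: "laplace w (\<lambda>b t. ?g (Fn 0) b * pf ?g (Fn 0 # t)) = 0"
    unfolding pf.simps(2)[of ?g "Fn 0" "Fn 0 # w"] by (simp del: pf.simps)
  have "pf ?g (Inf # w @ [Fn 0]) = pf ?g (Inf # Fn 0 # w)"
    using pf_move[OF skew_form, of f "[Inf]" w "Fn 0" "[]"] assms(2) by simp
  also have "\<dots> = pf ?g w - laplace w (\<lambda>b t. ?g Inf b * pf ?g (Fn 0 # t))"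
    unfolding pf.simps(2)[of ?g Inf] by (simp del: pf.simps)
  also have "laplace w (\<lambda>b t. ?g Inf b * pf ?g (Fn 0 # t)) = laplace w (\<lambda>b t. - (?g (Fn 0) b * pf ?g (Fn 0 # t)))"
    by (rule laplace_cong[OF refl]) (use assms(1) in simp)
  also have "\<dots> = 0"
    unfolding laplace_uminus null by simp
  finally show ?thesis by simp
qed

text \<open>For an odd number of points \<open>xs\<close>, completing them by \<open>Inf\<close> toggles the parity to which \<open>\<alpha>\<close> has to be
  padded: either \<open>Inf\<close> takes over from the padding \<open>0\<close> on the right-hand side of the equation, or \<open>Inf\<close>
  cancels against the padding \<open>0\<close> on its left-hand side.\<close>

lemma pf_pts_append:
  fixes f :: "nat \<Rightarrow> 'b::field_char_0 poly"
  assumes "f 0 = 1" "0 \<notin> set \<alpha>"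
  shows "pf (form f) (pts xs @ map Pt ys @ map Fn (pad (length ys) \<alpha>))
    = pf (form f) (map Pt (xs @ ys) @ map Fn (pad (length (xs @ ys)) \<alpha>))"
proof (cases "even (length xs)")
  case True
  then show ?thesis by (simp add: pts_def pad_def)
next
  case False
  let ?w = "map Pt (xs @ ys) @ map Fn \<alpha>"
  have neg: "form f Inf b = - form f (Fn 0) b" if "b \<in> set ?w" for b
    using that assms by (auto intro!: Nat.gr0I)
  show ?thesis
  proof (cases "even (length ys + length \<alpha>)")
    case True
    then have "pf (form f) (Inf # ?w) = pf (form f) (?w @ [Fn 0])"
      using False by (intro pf_Inf_odd neg) auto
    then show ?thesis using True False by (simp add: pts_def pad_def del: pf.simps)
  next
    case odd: False
    then have "pf (form f) (Inf # ?w @ [Fn 0]) = pf (form f) ?w"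
      using False by (intro pf_Inf_even neg) auto
    then show ?thesis using odd False by (simp add: pts_def pad_def del: pf.simps)
  qed
qed

lemma P_fun_append_eq_pf:
  fixes f :: "nat \<Rightarrow> 'b::field_char_0 poly"
  assumes "f 0 = 1" "0 \<notin> set \<alpha>"
  shows "P_fun f \<alpha> (xs @ ys) = pf (form f) (pts xs @ map Pt ys @ map Fn (pad (length ys) \<alpha>)) / Delta (xs @ ys)"
  unfolding P_fun_eq_pf pf_pts_append[of f, OF assms] ..

text \<open>This is Schur's Pfaffian again. It makes the convention for the part \<open>0\<close> in \<open>P_one\<close> agree with the
  word formula in \<open>P_one_eq_pf\<close>.\<close>

lemma P_fun_Nil:
  fixes f :: "nat \<Rightarrow> 'b::field_char_0 poly"
  assumes "f 0 = 1" "generic xs"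
  shows "P_fun f [] xs = 1"
  using P_fun_append_eq_pf[of f "[]" xs "[]"] assms pf_pts[OF assms(2)] Delta_neq_0[OF assms(2)]
  by (simp add: pad_def)

lemma P_one_eq_pf:
  fixes f :: "nat \<Rightarrow> 'b::field_char_0 poly"
  assumes "f 0 = 1" "generic (xs @ [t])"
  shows "P_one f r (xs @ [t]) = pf (form f) (pts xs @ [Pt t, Fn r]) / Delta (xs @ [t])"
proof (cases "r = 0")
  case True
  then show ?thesis
    using P_fun_Nil[of f, OF assms] P_fun_append_eq_pf[of f "[]" xs "[t]"] assms
    by (simp add: P_one_def pad_def del: pf.simps)
next
  case False
  then show ?thesis
    using P_fun_append_eq_pf[of f "[r]" xs "[t]"] assms
    by (simp add: P_one_def pad_def del: pf.simps)
qed

lemma P_two_eq_pf: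
  fixes f :: "nat \<Rightarrow> 'b::field_char_0 poly"
  assumes "f 0 = 1" "generic xs"
  shows "P_two f r s xs = pf (form f) (pts xs @ [Fn r, Fn s]) / Delta xs"
proof -
  let ?F = "\<lambda>r s. pf (form f) (pts xs @ [Fn r, Fn s])"
  have anti: "?F r s = - ?F s r" for r s
    by (rule pf_swap[OF skew_form])
  have one: "P_one f r xs = ?F r 0 / Delta xs" if "r \<noteq> 0" for r
    using P_fun_append_eq_pf[of f "[r]" xs "[]"] assms(1) that
    by (simp add: P_one_def pad_def del: pf.simps)
  have two: "P_fun f [r, s] xs = ?F r s / Delta xs" if "r \<noteq> 0" "s \<noteq> 0" for r s
    using P_fun_append_eq_pf[of f "[r, s]" xs "[]"] assms(1) that
    by (simp add: pad_def del: pf.simps)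
  have "?F r r = 0" using anti[of r r] by simp
  then show ?thesis
    unfolding P_two_def
    using one[of r] one[of s] two[of r s] two[of s r] anti[of r s] anti[of 0 s] by auto
qed

section \<open>Expansion in the basis of an admissible sequence\<close>

lemma admissible_coeff:
  assumes "admissible f"
  shows "coeff (f k) k \<noteq> 0" "k < n \<Longrightarrow> coeff (f k) n = 0"
proof -
  have deg: "degree (f k) = k"
    using assms by (cases "k = 0") (auto simp: admissible_def)
  show "coeff (f k) k \<noteq> 0"
  proof (cases "k = 0")
    case True
    then show ?thesis using assms by (simp add: admissible_def)
  next
    case False
    then show ?thesis using deg by (metis degree_0 leading_coeff_neq_0)
  qed
  show "k < n \<Longrightarrow> coeff (f k) n = 0"
    using deg by (simp add: coeff_eq_0)
qed

lemma admissible_span: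
  fixes f :: "nat \<Rightarrow> 'b::field poly"
  assumes "admissible f" "\<And>i. i \<ge> n \<Longrightarrow> coeff p i = 0"
  shows "\<exists>c. (\<forall>k\<ge>n. c k = 0) \<and> p = (\<Sum>k<n. smult (c k) (f k))"
  using assms(2)
proof (induction n arbitrary: p)
  case 0
  then have "p = 0" by (intro poly_eqI) simp
  then show ?case by auto
next
  case (Suc n)
  define a where "a = coeff p n / coeff (f n) n"
  have "coeff (p - smult a (f n)) i = 0" if "i \<ge> n" for i
    using Suc.prems[of i] that admissible_coeff[OF assms(1), of n] unfolding a_def
    by (cases "i = n") auto
  from Suc.IH[OF this] obtain c where c: "\<forall>k\<ge>n. c k = 0" "p - smult a (f n) = (\<Sum>k<n. smult (c k) (f k))"
    by blast
  have "p = (\<Sum>k<n. smult ((c(n := a)) k) (f k)) + smult a (f n)"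
    using c(2) by (simp add: diff_eq_eq)
  then have "p = (\<Sum>k<Suc n. smult ((c(n := a)) k) (f k))"
    by simp
  moreover have "\<forall>k\<ge>Suc n. (c(n := a)) k = 0" using c(1) by simp
  ultimately show ?case by blast
qed

lemma admissible_independent:
  fixes f :: "nat \<Rightarrow> 'b::field poly"
  assumes "admissible f" "(\<Sum>k<n. smult (c k) (f k)) = 0" "k < n"
  shows "c k = 0"
  using assms(2,3)
proof (induction n)
  case (Suc n)
  have "coeff (\<Sum>k<n. smult (c k) (f k)) n = 0"
    unfolding coeff_sum using admissible_coeff(2)[OF assms(1)] by (intro sum.neutral) auto
  moreover have "coeff (\<Sum>k<Suc n. smult (c k) (f k)) n = 0" using Suc.prems by simp
  ultimately have "c n = 0"
    using admissible_coeff(1)[OF assms(1), of n] by simp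
  then show ?case using Suc by (cases "k = n") auto
qed simp

text \<open>The coefficients \<open>R_coeffs\<close> are defined over a field of rational functions, and the results on
  Pfaffians have to be available there.\<close>

instance fract :: ("{idom, ring_char_0}") field_char_0
proof
  have "to_fract (of_nat n :: 'a) = of_nat n" for n
    by (induction n) auto
  then show "inj (of_nat :: nat \<Rightarrow> 'a fract)"
    by (metis injI of_nat_eq_iff to_fract_eq_iff)
qed

lemma field_hom_const: "field_hom const"
  by standard (auto simp: const_def simp flip: to_fract_add to_fract_mult one_pCons)

lemma const_eq_iff: "const a = const b \<longleftrightarrow> a = b"
  by (simp add: const_def)

lemma poly_new_var: "poly (map_poly const p) new_var = to_fract p"
proof -
  interpret field_hom const by (rule field_hom_const)
  show ?thesis
  proof (induction p)
    case (pCons a p)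
    have "to_fract (pCons a p) = const a + new_var * to_fract p"
      by (simp add: const_def new_var_def flip: to_fract_add to_fract_mult)
    then show ?case using pCons
      by (simp add: map_poly_pCons_hom)
  qed simp
qed

lemma generic_new_var:
  fixes xs :: "'b::field_char_0 list"
  assumes "generic xs"
  shows "generic (map const xs @ [new_var])"
proof -
  interpret field_hom const by (rule field_hom_const)
  have "const a + const b \<noteq> 0" if "a + b \<noteq> 0" for a b :: 'b
    using that by (simp flip: hom_add)
  moreover have "new_var + const a \<noteq> 0" "const a + new_var \<noteq> 0" "new_var \<noteq> const a" for a :: 'b
    by (simp_all add: const_def new_var_def flip: to_fract_add)
  moreover have "new_var + new_var \<noteq> (0 :: 'b poly fract)"
    by (simp add: new_var_def flip: to_fract_add)
  ultimately show ?thesis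
    using assms by (auto simp: generic_def distinct_map inj_on_def const_eq_iff)
qed

section \<open>One extra variable\<close>

text \<open>A Pfaffian with one more point has to be evaluated at points of the field itself and at the generic
  point \<open>new_var\<close>. Both evaluations are covered by stating the results for a homomorphism of fields
  into a field that contains the extra point.\<close>

lemma (in comm_ring_hom) hom_laplace: "hom (laplace w G) = laplace w (\<lambda>b t. hom (G b t))"
  by (induction w arbitrary: G) (auto simp: hom_distribs)

lemma (in comm_ring_hom) hom_pf: "hom (pf g w) = pf (\<lambda>a b. hom (g a b)) w"
proof (induction w rule: length_induct)
  case (1 w)
  show ?case
  proof (cases w)
    case (Cons a v)
    then show ?thesis
      using 1 by (auto simp: hom_laplace hom_distribs intro!: laplace_cong)
  qed simp
qed

lemma (in comm_ring_hom) hom_prod_list_map: "hom (prod_list (map F xs)) = prod_list (map (\<lambda>a. hom (F a)) xs)"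
  by (induction xs) (auto simp: hom_distribs)

context field_hom
begin

lemma hom_schur_form: "hom (schur_form a b) = schur_form (hom a) (hom b)"
  by (simp add: schur_form_def hom_distribs divide_inverse)

lemma hom_form: "hom (form f a b) = form (\<lambda>d. map_poly hom (f d)) (map_letter hom a) (map_letter hom b)"
  by (cases a; cases b) (auto simp: hom_schur_form hom_distribs)

lemma hom_pf_form:
  "pf (form (\<lambda>d. map_poly hom (f d))) (map (map_letter hom) w) = hom (pf (form f) w)"
  by (simp add: pf_map hom_pf hom_form)

lemma hom_Delta: "Delta (map hom xs) = hom (Delta xs)"
  by (induction xs) (auto simp: Delta_Cons hom_distribs hom_prod_list_map hom_schur_form o_def)

lemma map_letter_pts: "map (map_letter hom) (pts xs) = pts (map hom xs)"
  by (simp add: pts_def)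

lemma comm_ring_hom_eval: "comm_ring_hom (\<lambda>p. poly (map_poly hom p) t)"
proof -
  interpret map_poly_hom: map_poly_comm_ring_hom hom ..
  show ?thesis by standard (auto simp: hom_distribs map_poly_hom.hom_mult)
qed

end

text \<open>The entries \<open>form f (Pt t) b\<close>, as polynomials in \<open>t\<close>, multiplied by the common denominator.\<close>

fun cleared_row :: "'b::field list \<Rightarrow> 'b letter \<Rightarrow> 'b poly" where
  "cleared_row xs Inf = - prod_list (map (\<lambda>a. [:a, 1:]) xs)"
| "cleared_row xs (Pt a) = [:a, - 1:] * prod_list (map (\<lambda>a. [:a, 1:]) (remove1 a xs))"
| "cleared_row xs (Fn r) = 0"

text \<open>The expansion of \<open>pf (form f) (pts xs @ [Pt t, Fn r])\<close> along the letter \<open>Pt t\<close>, multiplied by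
  the product of all \<open>t + a\<close>, as a polynomial in \<open>t\<close>; see \<open>eval_numerator\<close>.\<close>

definition numerator :: "(nat \<Rightarrow> 'b::field poly) \<Rightarrow> nat \<Rightarrow> 'b list \<Rightarrow> 'b poly" where
  "numerator f r xs = smult (pf (form f) (pts xs)) (prod_list (map (\<lambda>a. [:a, 1:]) xs) * f r)
    - laplace (pts xs) (\<lambda>b w. smult (pf (form f) (Fn r # w)) (cleared_row xs b))"

lemma prod_list_map_remove1:
  "a \<in> set xs \<Longrightarrow> prod_list (map F xs) = F a * prod_list (map F (remove1 a xs))"
  for F :: "'a \<Rightarrow> 'b::comm_monoid_mult"
  by (induction xs) (auto simp: ac_simps)

context field_hom
begin

lemma eval_cleared_row:
  assumes "b \<in> set (pts xs)" "\<And>a. a \<in> set xs \<Longrightarrow> t + hom a \<noteq> 0"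
  shows "poly (map_poly hom (cleared_row xs b)) t
    = prod_list (map (\<lambda>a. t + hom a) xs) * form (\<lambda>d. map_poly hom (f d)) (Pt t) (map_letter hom b)"
proof -
  interpret ev: comm_ring_hom "\<lambda>p. poly (map_poly hom p) t" by (rule comm_ring_hom_eval)
  have lin: "poly (map_poly hom [:a, 1:]) t = t + hom a" "poly (map_poly hom [:a, - 1:]) t = hom a - t" for a
    by (simp_all add: hom_distribs)
  from assms(1) consider "b = Inf" | a where "b = Pt a" "a \<in> set xs"
    by (auto simp: pts_def split: if_splits)
  then show ?thesis
  proof cases
    case 1
    have "poly (map_poly hom (cleared_row xs b)) t = - prod_list (map (\<lambda>a. t + hom a) xs)"
      unfolding 1 by (simp only: cleared_row.simps ev.hom_uminus ev.hom_prod_list_map lin)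
    then show ?thesis using 1 by simp
  next
    case 2
    have "poly (map_poly hom (cleared_row xs b)) t = (hom a - t) * prod_list (map (\<lambda>a. t + hom a) (remove1 a xs))"
      using 2 by (simp only: cleared_row.simps ev.hom_mult ev.hom_prod_list_map lin)
    also have "\<dots> = ((t + hom a) * prod_list (map (\<lambda>a. t + hom a) (remove1 a xs))) * schur_form t (hom a)"
      using assms(2)[OF 2(2)] by (simp add: schur_form_def add.commute)
    finally show ?thesis
      using 2 prod_list_map_remove1[OF 2(2), of "\<lambda>a. t + hom a"] by simp
  qed
qed

end

lemma eval_numerator:
  fixes hom :: "'b::field_char_0 \<Rightarrow> 'c::field_char_0"
  assumes "field_hom hom" "\<And>a. a \<in> set xs \<Longrightarrow> t + hom a \<noteq> 0"
  shows "poly (map_poly hom (numerator f r xs)) t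
    = prod_list (map (\<lambda>a. t + hom a) xs)
      * pf (form (\<lambda>d. map_poly hom (f d))) (pts (map hom xs) @ [Pt t, Fn r])"
proof -
  interpret field_hom hom by fact
  interpret ev: comm_ring_hom "\<lambda>p. poly (map_poly hom p) t" by (rule comm_ring_hom_eval)
  let ?g = "form (\<lambda>d. map_poly hom (f d))" and ?X = "pts xs" and ?m = "map_letter hom"
  let ?c = "prod_list (map (\<lambda>a. t + hom a) xs)"
  have lin: "poly (map_poly hom [:a, 1:]) t = t + hom a" for a
    by (simp add: hom_distribs)
  have smult: "poly (map_poly hom (smult a p)) t = hom a * poly (map_poly hom p) t" for a p
    by (simp add: hom_distribs)
  have "pf ?g (pts (map hom xs) @ [Pt t, Fn r]) = pf ?g (Pt t # Fn r # map ?m ?X)"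
    using pf_move[OF skew_form, of _ "[]" "pts (map hom xs)" "Pt t" "[Fn r]"]
      pf_move[OF skew_form, of _ "[Pt t]" "pts (map hom xs)" "Fn r" "[]"]
      even_length_pts[of "map hom xs"]
    by (simp add: map_letter_pts del: pf.simps)
  also have "\<dots> = poly (map_poly hom (f r)) t * hom (pf (form f) ?X)
      - laplace ?X (\<lambda>b w. ?g (Pt t) (?m b) * pf ?g (map ?m (Fn r # w)))"
    unfolding pf.simps(2)[of ?g "Pt t"] by (simp add: laplace_map hom_pf_form[symmetric] del: pf.simps)
  also have "\<dots> = poly (map_poly hom (f r)) t * hom (pf (form f) ?X)
      - laplace ?X (\<lambda>b w. ?g (Pt t) (?m b) * hom (pf (form f) (Fn r # w)))"
    by (simp only: hom_pf_form)
  finally have "?c * pf ?g (pts (map hom xs) @ [Pt t, Fn r])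
      = hom (pf (form f) ?X) * (?c * poly (map_poly hom (f r)) t)
      - laplace ?X (\<lambda>b w. ?c * (?g (Pt t) (?m b) * hom (pf (form f) (Fn r # w))))"
    by (simp only: laplace_cmult) (simp add: algebra_simps)
  also have "laplace ?X (\<lambda>b w. ?c * (?g (Pt t) (?m b) * hom (pf (form f) (Fn r # w))))
      = laplace ?X (\<lambda>b w. poly (map_poly hom (smult (pf (form f) (Fn r # w)) (cleared_row xs b))) t)"
  proof (rule laplace_cong[OF refl])
    fix b w assume b: "b \<in> set ?X"
    show "?c * (?g (Pt t) (?m b) * hom (pf (form f) (Fn r # w)))
        = poly (map_poly hom (smult (pf (form f) (Fn r # w)) (cleared_row xs b))) t"
      unfolding smult using eval_cleared_row[OF b assms(2), of f] by (simp del: pf.simps)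
  qed
  finally show ?thesis
    unfolding numerator_def ev.hom_minus ev.hom_laplace smult ev.hom_mult ev.hom_prod_list_map lin
    by simp
qed

lemma prod_linear_dvd:
  fixes p :: "'b::field poly"
  assumes "distinct xs" "\<And>a. a \<in> set xs \<Longrightarrow> poly p a = 0"
  shows "prod_list (map (\<lambda>a. [:- a, 1:]) xs) dvd p"
  using assms
proof (induction xs arbitrary: p)
  case (Cons a xs)
  then obtain q where q: "p = [:- a, 1:] * q"
    by (metis dvdE list.set_intros(1) poly_eq_0_iff_dvd)
  have "poly q b = 0" if "b \<in> set xs" for b
    using Cons.prems(1) Cons.prems(2)[of b] that unfolding q by auto
  then have "prod_list (map (\<lambda>a. [:- a, 1:]) xs) dvd q"
    using Cons by auto
  then show ?case unfolding q by (simp only: list.map prod_list.Cons mult_dvd_mono[OF dvd_refl])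
qed simp

lemma field_hom_ident: "field_hom (\<lambda>a. a)"
  by standard auto

lemma Delta_snoc: "Delta (xs @ [t]) = Delta xs * prod_list (map (\<lambda>a. schur_form a t) xs)"
  by (simp add: Delta_append Delta_Cons)

text \<open>By \<open>P_one_eq_pf\<close> the value at \<open>t\<close> is the numerator divided by \<open>Delta xs\<close> and by the product of all
  \<open>t - a\<close> with \<open>a\<close> in \<open>xs\<close>. At \<open>t = a\<close> the Pfaffian has a repeated letter, so the
  numerator vanishes there and the division leaves a polynomial. The same polynomial serves for
  all points \<open>t\<close> and for \<open>new_var\<close>.\<close>

lemma P_one_polynomial:
  fixes f :: "nat \<Rightarrow> 'b::field_char_0 poly"
  assumes "f 0 = 1" "generic xs"
  shows "\<exists>p. (\<forall>t. generic (xs @ [t]) \<longrightarrow> P_one f r (xs @ [t]) = poly p t)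
    \<and> P_one (\<lambda>d. map_poly const (f d)) r (map const xs @ [new_var]) = poly (map_poly const p) new_var"
proof -
  let ?N = "numerator f r xs"
  have "poly ?N a = 0" if a: "a \<in> set xs" for a
  proof -
    have "a + b \<noteq> 0" if "b \<in> set xs" for b
      using assms(2) a that by (simp add: generic_def)
    then have "poly ?N a = prod_list (map (\<lambda>b. a + b) xs) * pf (form f) (pts xs @ [Pt a, Fn r])"
      using eval_numerator[OF field_hom_ident, of xs a f r] by simp
    moreover have "pf (form f) (Pt a # pts xs @ [Fn r]) = 0"
      by (rule pf_repeat[OF skew_form]) (use a in \<open>auto simp: pts_def\<close>)
    ultimately show ?thesis
      using pf_move[OF skew_form, of f "[]" "pts xs" "Pt a" "[Fn r]"] by (simp del: pf.simps)
  qed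
  then have "prod_list (map (\<lambda>a. [:- a, 1:]) xs) dvd ?N"
    using assms(2) by (intro prod_linear_dvd) (auto simp: generic_def)
  then obtain q where q: "?N = prod_list (map (\<lambda>a. [:- a, 1:]) xs) * q" ..
  define p where "p = smult (1 / Delta xs) q"
  have key: "P_one (\<lambda>d. map_poly hom (f d)) r (map hom xs @ [t]) = poly (map_poly hom p) t"
    if hom: "field_hom hom" and gen: "generic (map hom xs @ [t])" for hom :: "'b \<Rightarrow> 'c::field_char_0" and t
  proof -
    interpret field_hom hom by fact
    interpret ev: comm_ring_hom "\<lambda>p. poly (map_poly hom p) t" by (rule comm_ring_hom_eval)
    let ?g = "form (\<lambda>d. map_poly hom (f d))"
    let ?plus = "prod_list (map (\<lambda>a. t + hom a) xs)" and ?minus = "prod_list (map (\<lambda>a. t - hom a) xs)"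
    have t: "t + hom a \<noteq> 0" "t - hom a \<noteq> 0" if "a \<in> set xs" for a
      using gen that by (auto simp: generic_def)
    have pm: "?plus \<noteq> 0" "?minus \<noteq> 0"
      by (rule prod_list_neq_0, rule t, assumption)+
    have lin: "poly (map_poly hom [:- a, 1:]) t = t - hom a" for a
      by (simp add: hom_distribs)
    have "?minus * poly (map_poly hom q) t = ?plus * pf ?g (pts (map hom xs) @ [Pt t, Fn r])"
      using eval_numerator[OF hom, of xs t f r] t(1)
      unfolding q ev.hom_mult ev.hom_prod_list_map lin by simp
    then have num: "pf ?g (pts (map hom xs) @ [Pt t, Fn r]) = ?minus * poly (map_poly hom q) t / ?plus"
      using pm by (simp add: field_simps)
    have "prod_list (map (\<lambda>a. schur_form (hom a) t) xs) = ?minus / ?plus"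
      using t(1) by (induction xs) (auto simp: schur_form_def)
    then have den: "Delta (map hom xs @ [t]) = hom (Delta xs) * (?minus / ?plus)"
      by (simp add: Delta_snoc hom_Delta o_def)
    have "P_one (\<lambda>d. map_poly hom (f d)) r (map hom xs @ [t]) = poly (map_poly hom q) t / hom (Delta xs)"
      using P_one_eq_pf[of "\<lambda>d. map_poly hom (f d)" "map hom xs" t r] gen assms(1) pm
      unfolding num den by simp
    then show ?thesis by (simp add: p_def hom_distribs divide_inverse mult.commute)
  qed
  show ?thesis
    using key[OF field_hom_ident] key[OF field_hom_const generic_new_var[OF assms(2)]] by auto
qed

text \<open>At \<open>new_var\<close>, evaluation of polynomials is injective, so the equation that defines \<open>R_coeffs\<close> is the
  expansion of the polynomial from \<open>P_one_polynomial\<close> in the basis \<open>f\<close>. Its coefficients are unique and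
  can then be used at every generic point.\<close>

lemma R_fun_expansion:
  fixes f :: "nat \<Rightarrow> 'b::field_char_0 poly"
  assumes "admissible f" "generic xs"
  shows "\<exists>N. (\<forall>k\<ge>N. R_fun f r k xs = 0) \<and>
    (\<forall>t. generic (xs @ [t]) \<longrightarrow> P_one f r (xs @ [t]) = (\<Sum>k<N. R_fun f r k xs * poly (f k) t))"
proof -
  have "f 0 = 1" using assms(1) by (simp add: admissible_def)
  from P_one_polynomial[of f, OF this assms(2)] obtain p where p:
    "\<And>t. generic (xs @ [t]) \<Longrightarrow> P_one f r (xs @ [t]) = poly p t"
    "P_one (\<lambda>d. map_poly const (f d)) r (map const xs @ [new_var]) = to_fract p"
    unfolding poly_new_var by blast
  have "coeff p i = 0" if "i \<ge> Suc (degree p)" for i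
    using that by (simp add: coeff_eq_0)
  from admissible_span[OF assms(1) this] obtain c where
    c: "\<forall>k\<ge>Suc (degree p). c k = 0" "p = (\<Sum>k<Suc (degree p). smult (c k) (f k))"
    by blast
  let ?N = "Suc (degree p)"
  let ?Q = "\<lambda>c. finite {k. c k \<noteq> 0} \<and>
     P_one (\<lambda>d. map_poly const (f d)) r (map const xs @ [new_var]) =
       (\<Sum>k | c k \<noteq> 0. const (c k) * poly (map_poly const (f k)) new_var)"
  have bounded: "(\<Sum>k | d k \<noteq> 0. const (d k) * poly (map_poly const (f k)) new_var)
      = to_fract (\<Sum>k<n. smult (d k) (f k))" if "\<forall>k\<ge>n. d k = 0" for d :: "nat \<Rightarrow> 'b" and n
  proof -
    have "const (d k) * poly (map_poly const (f k)) new_var = to_fract (smult (d k) (f k))" for k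
      unfolding poly_new_var by (simp add: const_def flip: to_fract_mult)
    then have "(\<Sum>k | d k \<noteq> 0. const (d k) * poly (map_poly const (f k)) new_var)
        = to_fract (\<Sum>k | d k \<noteq> 0. smult (d k) (f k))"
      by simp
    also have "(\<Sum>k | d k \<noteq> 0. smult (d k) (f k)) = (\<Sum>k<n. smult (d k) (f k))"
      by (rule sum.mono_neutral_left) (use that not_le_imp_less in \<open>auto simp: not_le[symmetric]\<close>)
    finally show ?thesis .
  qed
  have "?Q c"
  proof
    show "finite {k. c k \<noteq> 0}"
      by (rule finite_subset[of _ "{..<?N}"]) (use c(1) in \<open>auto simp del: lessThan_Suc simp: not_le[symmetric]\<close>)
    show "P_one (\<lambda>d. map_poly const (f d)) r (map const xs @ [new_var]) =
        (\<Sum>k | c k \<noteq> 0. const (c k) * poly (map_poly const (f k)) new_var)"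
      unfolding bounded[OF c(1)] c(2)[symmetric] by (rule p(2))
  qed
  moreover have "d = c" if d: "?Q d" for d
  proof
    fix k
    obtain m where m: "\<forall>k\<in>{k. d k \<noteq> 0}. k < m"
      using d finite_nat_set_iff_bounded by blast
    let ?M = "max (Suc k) (max m ?N)"
    have dM: "\<forall>k\<ge>?M. d k = 0" and cM: "\<forall>k\<ge>?M. c k = 0"
      using m c(1) by (auto simp: not_le[symmetric])
    have "(\<Sum>k<?M. smult (d k) (f k)) = (\<Sum>k<?M. smult (c k) (f k))"
      using d \<open>?Q c\<close> unfolding bounded[OF dM] bounded[OF cM] by (simp del: to_fract_sum)
    then have "(\<Sum>k<?M. smult (d k - c k) (f k)) = 0"
      by (simp add: smult_diff_left sum_subtractf)
    then have "d k - c k = 0"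
      by (rule admissible_independent[OF assms(1)]) simp
    then show "d k = c k" by simp
  qed
  ultimately have "R_coeffs f r xs = c"
    unfolding R_coeffs_def by (rule the_equality)
  then have R: "R_fun f r k xs = c k" for k
    by (simp add: R_fun_def)
  have "poly p t = (\<Sum>k<?N. c k * poly (f k) t)" for t
    by (subst c(2)) (simp add: poly_sum del: sum.lessThan_Suc)
  then show ?thesis
    unfolding R using c(1) p(1) by (intro exI[of _ ?N]) (simp del: sum.lessThan_Suc)
qed

section \<open>Strict partitions and words of parts\<close>

lemma subseqs_sorted:
  "K \<in> set (subseqs xs) \<Longrightarrow> sorted_wrt R xs \<Longrightarrow> sorted_wrt R K \<and> set K \<subseteq> set xs"
proof (induction xs arbitrary: K)
  case (Cons x xs)
  then show ?case by (fastforce simp: Let_def)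
qed simp

lemma set_subseqs_upt:
  "set (subseqs (rev [0..<N])) = {K. sorted_wrt (>) K \<and> set K \<subseteq> {..<N}}"
proof (rule Set.set_eqI, rule iffI)
  fix K assume "K \<in> set (subseqs (rev [0..<N]))"
  moreover have "sorted_wrt (>) (rev [0..<N])"
    by (simp add: sorted_wrt_rev)
  ultimately show "K \<in> {K. sorted_wrt (>) K \<and> set K \<subseteq> {..<N}}"
    using subseqs_sorted[of K "rev [0..<N]" "(>)"] by auto
next
  fix K assume K: "K \<in> {K. sorted_wrt (>) K \<and> set K \<subseteq> {..<N}}"
  then have "set K \<subseteq> set (rev [0..<N])" by auto
  from subset_subseqs[OF this] obtain L where
    L: "L \<in> set (subseqs (rev [0..<N]))" "set L = set K" by auto
  have "sorted_wrt (>) L"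
    using subseqs_sorted[OF L(1), of "(>)"] by (simp add: sorted_wrt_rev)
  then have "rev L = rev K"
    using K L(2) by (intro strict_sorted_equal) (simp_all add: sorted_wrt_rev)
  then show "K \<in> set (subseqs (rev [0..<N]))" using L(1) by simp
qed

lemma subseqs_map: "subseqs (map F xs) = map (map F) (subseqs xs)"
  by (induction xs) (auto simp: Let_def)

lemma sum_list_subseqs_upt:
  "(\<Sum>K\<leftarrow>subseqs (rev [0..<N]). F K) = (\<Sum>K | sorted_wrt (>) K \<and> set K \<subseteq> {..<N}. F K)"
proof -
  have "distinct (map set (subseqs (rev [0..<N])))"
    by (rule distinct_set_subseqs) simp
  then have "distinct (subseqs (rev [0..<N]))"
    by (simp add: distinct_map)
  then show ?thesis
    by (simp add: sum_list_distinct_conv_sum_set set_subseqs_upt)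
qed

lemma sorted_filter_zero:
  "sorted_wrt (>) K \<Longrightarrow> (0::nat) \<in> set K \<Longrightarrow> filter (\<lambda>a. 0 < a) K @ [0] = K"
proof (induction K)
  case (Cons a K)
  then show ?case by (cases K) auto
qed simp

lemma filter_pad:
  "strict_partition \<mu> \<Longrightarrow> filter (\<lambda>a. 0 < a) (pad p \<mu>) = \<mu>"
  by (auto simp: pad_def strict_partition_def)

text \<open>A strictly decreasing sequence of nonnegative integers is a strict partition, possibly followed by
  \<open>0\<close>. Once the parity of the length is prescribed, the partition decides whether \<open>0\<close> is there.\<close>

lemma bij_betw_pad:
  assumes "0 < N"
  shows "bij_betw (pad p) {\<mu>. strict_partition \<mu> \<and> set \<mu> \<subseteq> {..<N}}
    {K. sorted_wrt (>) K \<and> set K \<subseteq> {..<N} \<and> even (p + length K)}"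
proof (rule bij_betwI[where g = "filter (\<lambda>a. 0 < a)"])
  show "pad p \<in> {\<mu>. strict_partition \<mu> \<and> set \<mu> \<subseteq> {..<N}}
      \<rightarrow> {K. sorted_wrt (>) K \<and> set K \<subseteq> {..<N} \<and> even (p + length K)}"
    using assms by (auto simp: pad_def strict_partition_def sorted_wrt_append)
  show "filter (\<lambda>a. 0 < a) \<in> {K. sorted_wrt (>) K \<and> set K \<subseteq> {..<N} \<and> even (p + length K)}
      \<rightarrow> {\<mu>. strict_partition \<mu> \<and> set \<mu> \<subseteq> {..<N}}"
    by (auto simp: strict_partition_def sorted_wrt_filter)
  show "filter (\<lambda>a. 0 < a) (pad p \<mu>) = \<mu>" if "\<mu> \<in> {\<mu>. strict_partition \<mu> \<and> set \<mu> \<subseteq> {..<N}}" for \<mu>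
    using that filter_pad by auto
  show "pad p (filter (\<lambda>a. 0 < a) K) = K"
    if "K \<in> {K. sorted_wrt (>) K \<and> set K \<subseteq> {..<N} \<and> even (p + length K)}" for K
  proof -
    let ?F = "filter (\<lambda>a. 0 < a) K"
    have K: "sorted_wrt (>) K" "even (p + length K)" using that by auto
    show ?thesis
    proof (cases "0 \<in> set K")
      case True
      then have "?F @ [0] = K" using sorted_filter_zero[OF K(1)] by simp
      moreover from this have "length K = Suc (length ?F)"
        by (metis length_append_singleton)
      ultimately show ?thesis using K(2) by (simp add: pad_def)
    next
      case False
      then have "?F = K" by (intro filter_True) (auto intro!: Nat.gr0I)
      then show ?thesis using K(2) by (simp add: pad_def)
    qed
  qed
qed

section \<open>The two factors of the expansion\<close>

text \<open>The entries of the matrix in the definition of \<open>P_skew\<close>: \<open>Inr r\<close> stands for a part \<open>r\<close> of the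
  outer partition, \<open>Inl k\<close> for a part \<open>k\<close> of the inner one.\<close>

fun skew_entries :: "(nat \<Rightarrow> 'b::field poly) \<Rightarrow> 'b list \<Rightarrow> nat + nat \<Rightarrow> nat + nat \<Rightarrow> 'b" where
  "skew_entries f xs (Inr r) (Inr s) = P_two f r s xs"
| "skew_entries f xs (Inr r) (Inl k) = R_fun f r k xs"
| "skew_entries f xs (Inl k) (Inr r) = - R_fun f r k xs"
| "skew_entries f xs (Inl k) (Inl l) = 0"

lemma skew_skew_entries: "skew (skew_entries f xs)"
  unfolding skew_def
proof (intro allI)
  show "skew_entries f xs a b = - skew_entries f xs b a" for a b
    by (cases a; cases b) (auto simp: P_two_def)
qed

lemma even_pad: "even (k + length (pad k \<alpha>))"
  by (simp add: pad_def)

lemma P_skew_eq_pf: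
  fixes xs :: "'b::field_char_0 list"
  shows "P_skew f \<alpha> \<beta> p xs = pf (skew_entries f xs) (map Inr (pad p \<alpha>) @ map Inl (rev (pad p \<beta>)))"
proof -
  let ?u = "map Inr (pad p \<alpha>) :: (nat + nat) list" and ?v = "map Inl (rev (pad p \<beta>)) :: (nat + nat) list"
  have S: "S_mat f (pad p \<alpha>) xs = mat (length ?u) (length ?u) (\<lambda>(i, j). skew_entries f xs (?u ! i) (?u ! j))"
    by (rule eq_matI) (auto simp: S_mat_def)
  have M: "M_mat f (pad p \<alpha>) (pad p \<beta>) xs
      = mat (length ?u) (length ?v) (\<lambda>(i, j). skew_entries f xs (?u ! i) (?v ! j))"
    by (rule eq_matI) (auto simp: M_mat_def rev_nth)
  have "even (length ?u + length ?v)"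
    using even_pad[of p \<alpha>] even_pad[of p \<beta>] by auto
  then show ?thesis
    unfolding P_skew_def S M by (subst pfaffian_bordered[OF skew_skew_entries]) auto
qed

text \<open>The inner part \<open>k\<close> then indexes a row of zeros. With \<open>R_fun_expansion\<close> this makes the sum over all inner
  partitions finite.\<close>

lemma P_skew_eq_0:
  fixes xs :: "'b::field_char_0 list"
  assumes "k \<in> set \<beta>" "\<And>r. r \<in> set (pad p \<alpha>) \<Longrightarrow> R_fun f r k xs = 0"
  shows "P_skew f \<alpha> \<beta> p xs = 0"
  unfolding P_skew_eq_pf
proof (rule pf_null_letter[OF _ _ skew_skew_entries])
  show "Inl k \<in> set (map Inr (pad p \<alpha>) @ map Inl (rev (pad p \<beta>)))"
    using assms(1) by (auto simp: pad_def)
  show "skew_entries f xs (Inl k) b = 0" if "b \<in> set (map Inr (pad p \<alpha>) @ map Inl (rev (pad p \<beta>)))" for b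
    using that assms(2) by auto
qed

text \<open>In \<open>P_skew\<close> the inner parts stand to the right of the outer parts, while the minor summation formula
  yields them on the left, with the coefficients \<open>R_fun\<close> as entries above the diagonal. Changing
  the sign of the inner letters reconciles the two.\<close>

definition column_sign :: "nat + nat \<Rightarrow> 'b::field" where
  "column_sign = case_sum (\<lambda>_. - 1) (\<lambda>_. 1)"

text \<open>The signs of the inner letters give \<open>(- 1) ^ length K\<close>, and moving them past \<open>L\<close> gives
  \<open>(- 1) ^ (length K * length L)\<close>. These cancel when the lengths have the same parity.\<close>

lemma pf_column_sign:
  fixes xs :: "'b::field_char_0 list"
  assumes "even (length K + length L)"
  shows "pf (\<lambda>a b. column_sign a * column_sign b * skew_entries f xs a b) (map Inl (rev K) @ map Inr L)
    = pf (skew_entries f xs) (map Inr L @ map Inl (rev K))"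
proof -
  have "map column_sign (map Inl (rev K) @ map Inr L) = replicate (length K) (- 1 :: 'b) @ replicate (length L) 1"
    by (simp add: column_sign_def o_def map_replicate_const)
  then have "pf (\<lambda>a b. column_sign a * column_sign b * skew_entries f xs a b) (map Inl (rev K) @ map Inr L)
      = (- 1) ^ length K * pf (skew_entries f xs) (map Inl (rev K) @ map Inr L)"
    unfolding pf_scale by simp
  also have "\<dots> = (- 1) ^ (length K + length K * length L) * pf (skew_entries f xs) (map Inr L @ map Inl (rev K))"
    using pf_rotate[OF skew_skew_entries, of f xs "map Inl (rev K)" "map Inr L"]
    by (simp add: power_add)
  also have "even (length K + length K * length L)"
    using assms by auto
  then have "(- 1 :: 'b) ^ (length K + length K * length L) = 1"
    by (rule neg_one_even_power)
  finally show ?thesis by simp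
qed

section \<open>The splitting formula\<close>

text \<open>The word for \<open>P\<^sub>\<lambda>(x, y)\<close> without its letters \<open>x\<close> is rewritten over the alphabet of
  \<open>joined (form f) h D\<close>; this map goes back.\<close>

fun evaluate :: "'b letter + (nat + nat) \<Rightarrow> 'b letter" where
  "evaluate (Inl a) = a"
| "evaluate (Inr (Inr r)) = Fn r"
| "evaluate (Inr (Inl k)) = Fn k"

text \<open>The factor that a further point contributes when Schur's form is replaced by its quotient by the
  points \<open>xs\<close>.\<close>

definition weight :: "'b::field list \<Rightarrow> 'b letter + (nat + nat) \<Rightarrow> 'b" where
  "weight xs w = (case w of Inl (Pt t) \<Rightarrow> prod_list (map (\<lambda>a. schur_form a t) xs) | _ \<Rightarrow> 1)"

text \<open>Dividing the Pfaffian for \<open>xs @ ys\<close> by the Pfaffian of the points \<open>xs\<close> leaves the letters \<open>ys\<close> and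
  the parts. By \<open>pf_pts\<close>, \<open>P_one_eq_pf\<close> and \<open>P_two_eq_pf\<close> the entries of the quotient form are, up to
  a factor \<open>weight\<close> for each point, the Schur form between points, \<open>P\<^bsub>(r)\<^esub>(xs, t)\<close> between a point \<open>t\<close> and
  a part \<open>r\<close>, and \<open>P\<^bsub>(r,s)\<^esub>(xs)\<close> between parts. The expansion of \<open>P\<^bsub>(r)\<^esub>(xs, t)\<close> writes the mixed
  entries as a matrix product over the indices \<open>k < N\<close>. The factors \<open>weight\<close> cancel against the mixed
  factors of \<open>Delta (xs @ ys)\<close>.\<close>

lemma P_fun_append_eq_joined:
  fixes f :: "nat \<Rightarrow> 'b::field_char_0 poly"
  assumes adm: "admissible f" and lam: "0 \<notin> set \<alpha>" and gen: "generic (xs @ ys)"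
    and N: "\<And>r t. r \<in> set (pad (length ys) \<alpha>) \<Longrightarrow> generic (xs @ [t]) \<Longrightarrow>
      P_one f r (xs @ [t]) = (\<Sum>k<N. R_fun f r k xs * poly (f k) t)"
  defines "h \<equiv> \<lambda>a b. column_sign a * column_sign b * skew_entries f xs a b"
    and "D \<equiv> map (\<lambda>k. (Fn k, Inl k)) (rev [0..<N])"
  shows "P_fun f \<alpha> (xs @ ys) = pf (joined (form f) h D)
    (map Inl (map Pt ys) @ map Inr (map Inr (pad (length ys) \<alpha>))) / Delta ys"
proof -
  let ?g = "form f" and ?L = "pad (length ys) \<alpha>"
  let ?W = "map Inl (map Pt ys) @ map Inr (map Inr ?L) :: ('b letter + (nat + nat)) list"
  have f0: "f 0 = 1" using adm by (simp add: admissible_def)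
  have gx: "generic xs" and gy: "generic ys" using generic_append[OF gen] .
  have X: "pf ?g (pts xs) = Delta xs" by (rule pf_pts[OF gx])
  have D0: "Delta xs \<noteq> 0" by (rule Delta_neq_0[OF gx])
  have gt: "generic (xs @ [t])" if "t \<in> set ys" for t
    using gen that by (intro generic_mono[OF gen]) (auto simp: generic_def)
  have u: "Delta (xs @ [t]) = Delta xs * weight xs (Inl (Pt t))" for t
    by (simp add: Delta_snoc weight_def)
  have col: "(\<Sum>(d, e)\<leftarrow>D. ?g (Pt t) d * h e (Inr r)) = P_one f r (xs @ [t])"
    if "r \<in> set ?L" "t \<in> set ys" for t r
  proof -
    have "(\<Sum>(d, e)\<leftarrow>D. ?g (Pt t) d * h e (Inr r)) = (\<Sum>k\<leftarrow>rev [0..<N]. R_fun f r k xs * poly (f k) t)"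
      by (simp add: D_def h_def o_def column_sign_def mult.commute)
    also have "\<dots> = (\<Sum>k<N. R_fun f r k xs * poly (f k) t)"
      by (simp add: sum_list_distinct_conv_sum_set atLeast0LessThan)
    finally show ?thesis using N[OF that(1) gt[OF that(2)]] by simp
  qed
  have PP: "pf ?g (pts xs @ [Pt s, Pt t]) / Delta xs = weight xs (Inl (Pt s)) * weight xs (Inl (Pt t)) * schur_form s t"
    if st: "s \<in> set ys" "t \<in> set ys" for s t
  proof (cases "s = t")
    case True
    have "pf ?g (pts xs @ [Pt s, Pt s]) = 0"
      using pf_swap[OF skew_form, of f "pts xs" "Pt s" "Pt s" "[]"] by simp
    then show ?thesis using True skew_diag[OF skew_schur_form, of s] by simp
  next
    case False
    have g2: "generic (xs @ [s, t])"
      using gen st False by (intro generic_mono[OF gen]) (auto simp: generic_def)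
    have "pts xs @ [Pt s, Pt t] = pts (xs @ [s, t])" by (simp add: pts_def)
    then show ?thesis
      using pf_pts[OF g2, of f] D0 by (simp add: Delta_append Delta_Cons weight_def)
  qed
  have PF: "pf ?g (pts xs @ [Pt t, Fn r]) / Delta xs = weight xs (Inl (Pt t)) * P_one f r (xs @ [t])"
    if "t \<in> set ys" for t r
    using P_one_eq_pf[of f xs t r, OF f0 gt[OF that]] Delta_neq_0[OF gt[OF that]] D0 unfolding u
    by (simp add: field_simps del: pf.simps)
  have FF: "pf ?g (pts xs @ [Fn r, Fn s]) / Delta xs = P_two f r s xs" for r s
    using P_two_eq_pf[of f xs r s, OF f0 gx] by simp
  let ?q = "\<lambda>a b. pf ?g (pts xs @ [a, b]) / Delta xs"
  have entries: "?q (evaluate a) (evaluate b) = weight xs a * weight xs b * joined ?g h D a b"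
    if "a \<in> set ?W" "b \<in> set ?W" for a b
  proof -
    from that(1) consider (PA) t where "a = Inl (Pt t)" "t \<in> set ys" | (FA) r where "a = Inr (Inr r)" "r \<in> set ?L"
      by auto
    note ca = this
    from that(2) consider (PB) t where "b = Inl (Pt t)" "t \<in> set ys" | (FB) r where "b = Inr (Inr r)" "r \<in> set ?L"
      by auto
    note cb = this
    show ?thesis
    proof (cases rule: ca)
      case (PA s)
      note A = PA
      show ?thesis
      proof (cases rule: cb)
        case (PB t)
        then show ?thesis using A PP by simp
      next
        case (FB r)
        then show ?thesis using A PF[of s r] col[of r s] by (simp add: weight_def)
      qed
    next
      case (FA r)
      note A = FA
      show ?thesis
      proof (cases rule: cb)
        case (PB t)
        have "pf ?g (pts xs @ [Fn r, Pt t]) = - pf ?g (pts xs @ [Pt t, Fn r])"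
          by (rule pf_swap[OF skew_form])
        then show ?thesis using A PB PF[of t r] col[of r t] by (simp add: weight_def)
      next
        case (FB s)
        then show ?thesis using A FF by (simp add: weight_def h_def column_sign_def)
      qed
    qed
  qed
  have "pf ?g (pts xs @ map Pt ys @ map Fn ?L) = Delta xs * pf ?q (map Pt ys @ map Fn ?L)"
    using pf_quotient[OF skew_form even_length_pts, of f xs "map Pt ys @ map Fn ?L"] X D0
    by (simp add: field_simps)
  also have "pf ?q (map Pt ys @ map Fn ?L) = pf ?q (map evaluate ?W)" by (simp add: o_def)
  also have "pf ?q (map evaluate ?W) = pf (\<lambda>a b. weight xs a * weight xs b * joined ?g h D a b) ?W"
    unfolding pf_map by (rule pf_cong) (rule entries)
  also have "\<dots> = prod_list (map (weight xs) ?W) * pf (joined ?g h D) ?W"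
    by (rule pf_scale)
  also have "prod_list (map (weight xs) ?W) = prod_list (map (\<lambda>t. weight xs (Inl (Pt t))) ys)"
    by (simp add: weight_def o_def map_replicate_const)
  finally have num: "pf ?g (pts xs @ map Pt ys @ map Fn ?L)
      = Delta xs * (prod_list (map (\<lambda>t. weight xs (Inl (Pt t))) ys) * pf (joined ?g h D) ?W)" .
  have den: "Delta (xs @ ys) = Delta xs * Delta ys * prod_list (map (\<lambda>t. weight xs (Inl (Pt t))) ys)"
    by (simp add: Delta_append weight_def)
  show ?thesis
    using P_fun_append_eq_pf[of f \<alpha> xs ys, OF f0 lam] Delta_neq_0[OF gen]
    unfolding num den by simp
qed

text \<open>The minor summation formula turns \<open>P_fun_append_eq_joined\<close> into a sum over strictly decreasing
  sequences \<open>K\<close>. Those of the wrong parity contribute \<open>0\<close>, as they yield words of odd length, and the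
  others are the padded strict partitions.\<close>

theorem P_fun_splitting:
  fixes f :: "nat \<Rightarrow> 'b::field_char_0 poly"
  assumes adm: "admissible f" and lam: "strict_partition \<alpha>" and gen: "generic (xs @ ys)"
  shows "finite {\<mu>. strict_partition \<mu> \<and> P_skew f \<alpha> \<mu> (length ys) xs * P_fun f \<mu> ys \<noteq> 0} \<and>
    P_fun f \<alpha> (xs @ ys) = (\<Sum>\<mu> | strict_partition \<mu> \<and> P_skew f \<alpha> \<mu> (length ys) xs * P_fun f \<mu> ys \<noteq> 0.
      P_skew f \<alpha> \<mu> (length ys) xs * P_fun f \<mu> ys)"
proof -
  let ?p = "length ys"
  let ?L = "pad ?p \<alpha>" and ?g = "form f"
  have "\<forall>r. \<exists>n. (\<forall>k\<ge>n. R_fun f r k xs = 0) \<and>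
    (\<forall>t. generic (xs @ [t]) \<longrightarrow> P_one f r (xs @ [t]) = (\<Sum>k<n. R_fun f r k xs * poly (f k) t))"
    using R_fun_expansion[OF adm generic_append(1)[OF gen]] by blast
  then obtain n where n: "\<And>r k. k \<ge> n r \<Longrightarrow> R_fun f r k xs = 0"
    "\<And>r t. generic (xs @ [t]) \<Longrightarrow> P_one f r (xs @ [t]) = (\<Sum>k<n r. R_fun f r k xs * poly (f k) t)"
    by metis
  \<comment> \<open>The successor makes \<open>N\<close> positive, so that a padding \<open>0\<close> is among the indices below \<open>N\<close>.\<close>
  define N where "N = Suc (\<Sum>r\<leftarrow>?L. n r)"
  have le: "n r \<le> N" if "r \<in> set ?L" for r
    using member_le_sum_list[of "n r" "map n ?L"] that unfolding N_def by auto
  have R0: "R_fun f r k xs = 0" if "r \<in> set ?L" "k \<ge> N" for r k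
    using n(1)[of r k] le[OF that(1)] that(2) by simp
  have exp: "P_one f r (xs @ [t]) = (\<Sum>k<N. R_fun f r k xs * poly (f k) t)"
    if "r \<in> set ?L" "generic (xs @ [t])" for r t
    unfolding n(2)[OF that(2)]
    by (rule sum.mono_neutral_left) (use le[OF that(1)] n(1) in auto)
  define h where "h = (\<lambda>a b. column_sign a * column_sign b * skew_entries f xs a b)"
  define D where "D = map (\<lambda>k. (Fn k :: 'b letter, Inl k :: nat + nat)) (rev [0..<N])"
  define G where "G = (\<lambda>K. pf ?g (map Pt ys @ map Fn K) / Delta ys * pf h (map Inl (rev K) @ map Inr ?L))"
  have "skew h"
    unfolding skew_def
  proof (intro allI)
    show "h a b = - h b a" for a b
      unfolding h_def using skewD[OF skew_skew_entries, of f xs a b] by (simp add: mult.commute)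
  qed
  have "0 \<notin> set \<alpha>" using lam by (auto simp: strict_partition_def)
  then have "P_fun f \<alpha> (xs @ ys) = pf (joined ?g h D) (map Inl (map Pt ys) @ map Inr (map Inr ?L)) / Delta ys"
    unfolding h_def D_def using P_fun_append_eq_joined[OF adm _ gen exp] by blast
  also have "\<dots> = (\<Sum>K\<leftarrow>subseqs D. pf ?g (map Pt ys @ map fst K) * pf h (rev (map snd K) @ map Inr ?L)) / Delta ys"
  proof (rule arg_cong[where f = "\<lambda>c. c / Delta ys"], rule pf_minor_summation[OF skew_form \<open>skew h\<close>])
    show "?g d d' = 0" if "d \<in> fst ` set D" "d' \<in> fst ` set D" for d d'
      using that by (auto simp: D_def)
    show "h e e' = 0" if "e \<in> snd ` set D" "e' \<in> snd ` set D" for e e'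
      using that by (auto simp: D_def h_def)
  qed
  \<comment> \<open>The pairs in \<open>D\<close> are listed by decreasing index, so that their subsequences are decreasing.\<close>
  also have "\<dots> = (\<Sum>K\<leftarrow>subseqs (rev [0..<N]). G K)"
    unfolding D_def subseqs_map G_def divide_inverse sum_list_mult_const[symmetric]
    by (simp add: o_def rev_map mult_ac del: pf.simps)
  also have "\<dots> = (\<Sum>K | sorted_wrt (>) K \<and> set K \<subseteq> {..<N}. G K)"
    by (rule sum_list_subseqs_upt)
  also have "\<dots> = (\<Sum>K | sorted_wrt (>) K \<and> set K \<subseteq> {..<N} \<and> even (?p + length K). G K)"
  proof (rule sum.mono_neutral_right)
    show "finite {K. sorted_wrt (>) K \<and> set K \<subseteq> {..<N}}"
      unfolding set_subseqs_upt[symmetric] by simp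
    show "\<forall>K\<in>{K. sorted_wrt (>) K \<and> set K \<subseteq> {..<N}} - {K. sorted_wrt (>) K \<and> set K \<subseteq> {..<N} \<and> even (?p + length K)}. G K = 0"
      by (auto simp: G_def pf_odd)
  qed auto
  also have "\<dots> = (\<Sum>\<mu> | strict_partition \<mu> \<and> set \<mu> \<subseteq> {..<N}. G (pad ?p \<mu>))"
    by (rule sum.reindex_bij_betw[OF bij_betw_pad, symmetric]) (simp add: N_def)
  also have "\<dots> = (\<Sum>\<mu> | strict_partition \<mu> \<and> set \<mu> \<subseteq> {..<N}. P_skew f \<alpha> \<mu> ?p xs * P_fun f \<mu> ys)"
  proof (rule sum.cong[OF refl])
    fix \<mu>
    have "even (length (pad ?p \<mu>) + length ?L)"
      using even_pad[of ?p \<mu>] even_pad[of ?p \<alpha>] by auto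
    then show "G (pad ?p \<mu>) = P_skew f \<alpha> \<mu> ?p xs * P_fun f \<mu> ys"
      unfolding G_def h_def P_skew_eq_pf P_fun_eq_pf by (simp add: pf_column_sign mult.commute)
  qed
  finally have sum: "P_fun f \<alpha> (xs @ ys)
    = (\<Sum>\<mu> | strict_partition \<mu> \<and> set \<mu> \<subseteq> {..<N}. P_skew f \<alpha> \<mu> ?p xs * P_fun f \<mu> ys)" .
  let ?B = "{\<mu>. strict_partition \<mu> \<and> set \<mu> \<subseteq> {..<N}}"
  let ?A = "{\<mu>. strict_partition \<mu> \<and> P_skew f \<alpha> \<mu> ?p xs * P_fun f \<mu> ys \<noteq> 0}"
  have fin: "finite ?B"
  proof (rule finite_subset)
    show "?B \<subseteq> {K. sorted_wrt (>) K \<and> set K \<subseteq> {..<N}}" by (auto simp: strict_partition_def)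
    show "finite {K. sorted_wrt (>) K \<and> set K \<subseteq> {..<N}}"
      unfolding set_subseqs_upt[symmetric] by simp
  qed
  have sub: "?A \<subseteq> ?B"
  proof
    fix \<mu> assume \<mu>: "\<mu> \<in> ?A"
    have "k < N" if "k \<in> set \<mu>" for k
    proof (rule ccontr)
      assume "\<not> k < N"
      then have "P_skew f \<alpha> \<mu> ?p xs = 0"
        using R0 that by (intro P_skew_eq_0[of k]) auto
      then show False using \<mu> by simp
    qed
    then show "\<mu> \<in> ?B" using \<mu> by auto
  qed
  have "(\<Sum>\<mu>\<in>?B. P_skew f \<alpha> \<mu> ?p xs * P_fun f \<mu> ys) = (\<Sum>\<mu>\<in>?A. P_skew f \<alpha> \<mu> ?p xs * P_fun f \<mu> ys)"
    by (rule sum.mono_neutral_right[OF fin sub]) auto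
  then show ?thesis
    using sum finite_subset[OF sub fin] by simp
qed

section \<open>Indeterminates\<close>

text \<open>The sum of two generators has coefficient \<open>1\<close> or \<open>2\<close> at either of them.\<close>

lemma generic_indet: "distinct is \<Longrightarrow> generic (map indet is :: 'a::field_char_0 ratfun list)"
proof -
  let ?X = "\<lambda>i. Poly_Mapping.single (Poly_Mapping.single i 1) 1 :: (nat \<Rightarrow>\<^sub>0 nat) \<Rightarrow>\<^sub>0 'a"
  have mono: "Poly_Mapping.single i (1 :: nat) = Poly_Mapping.single j 1 \<longleftrightarrow> i = j" for i j :: nat
  proof
    assume "Poly_Mapping.single i (1 :: nat) = Poly_Mapping.single j 1"
    then have "Poly_Mapping.lookup (Poly_Mapping.single i (1 :: nat)) j = Poly_Mapping.lookup (Poly_Mapping.single j 1) j"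
      by (rule arg_cong)
    then show "i = j" by (simp add: lookup_single when_def split: if_splits)
  qed simp
  have X: "Poly_Mapping.lookup (?X i) (Poly_Mapping.single j 1) = (if i = j then 1 else 0)" for i j
    by (simp only: lookup_single mono when_def)
  have inj: "?X i = ?X j \<longleftrightarrow> i = j" for i j
    using X[of i j] X[of j j] by (cases "i = j") auto
  have "?X i + ?X j \<noteq> 0" for i j
  proof
    assume "?X i + ?X j = 0"
    then have "Poly_Mapping.lookup (?X i + ?X j) (Poly_Mapping.single i 1) = 0" by simp
    then have "(1 :: 'a) + (if j = i then 1 else 0) = 0"
      unfolding lookup_add X by simp
    then show False by (simp split: if_splits)
  qed
  then have "indet i + indet j \<noteq> (0 :: 'a ratfun)" for i j
    unfolding indet_def to_fract_add[symmetric] to_fract_eq_0_iff .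
  then show "distinct is \<Longrightarrow> generic (map indet is :: 'a ratfun list)"
    using inj by (auto simp: generic_def distinct_map inj_on_def indet_def)
qed

lemma admissible_scalar:
  assumes "admissible F"
  shows "admissible (\<lambda>d. map_poly scalar (F d))"
proof -
  have s0: "scalar c = 0 \<longleftrightarrow> c = 0" for c :: 'a
    by (simp add: scalar_def) (metis lookup_single_eq lookup_zero single_zero)
  have "scalar (1 :: 'a) = 1" by (simp add: scalar_def)
  moreover have "degree (map_poly scalar q) = degree q" for q :: "'a poly"
    by (rule degree_map_poly) (use s0 in auto)
  ultimately show ?thesis
    using assms by (auto simp: admissible_def)
qed

theorem theorem4p2:
  fixes F :: "nat \<Rightarrow> 'a::field_char_0 poly"
    and f :: "nat \<Rightarrow> 'a ratfun poly"
    and lam :: "nat list"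
    and n p :: nat
    and x y :: "'a ratfun list"
  assumes "admissible F"
    and "strict_partition lam"
    and "p \<ge> 1"
    and "f = (\<lambda>d. map_poly scalar (F d))"
    and "x = map indet [0..<n]"
    and "y = map indet [n..<n + p]"
  shows "finite {mu. strict_partition mu \<and> P_skew f lam mu p x * P_fun f mu y \<noteq> 0} \<and>
    P_fun f lam (x @ y) =
      (\<Sum>mu | strict_partition mu \<and> P_skew f lam mu p x * P_fun f mu y \<noteq> 0.
         P_skew f lam mu p x * P_fun f mu y)"
proof -
  have "admissible f"
    unfolding assms(4) by (rule admissible_scalar) fact
  moreover have "generic (x @ y)"
    unfolding assms(5,6) map_append[symmetric] by (rule generic_indet) simp
  moreover have "length y = p" using assms(6) by simp
  ultimately show ?thesis
    using P_fun_splitting[of f lam x y] assms(2) by simp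
qed

end
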